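(* Let $T$ be a $C_0$-semigroup on a complex Banach space $X$, with generator $A$. The following are equivalent: (i) There is an equivalent norm $\|\cdot\|_*$ on $X$ such that $-A$ is dissipative with respect to $(X,\|\cdot\|_* )$. (ii) There is a Banach space $Y$ in which $X$ is isomorphically embedded, and a $C_0$-group $S$ on $Y$ such that $\|S(-t)\|_{\mathcal{B}(Y)} \le 1$ and $S(t)x = T(t)x$ for all $x \in X$, $t>0$ (where $X$ is identified with its image in $Y$). (iii) There is a $C_0$-group extension $S$ of $T$ on a Banach space $Z \supseteq X$ and a constant $\kappa$ such that $\|S(-t)\|_{\mathcal{B}(Z)} \le \kappa$ for all $t\ge0$. (iv) There exists $\kappa$ such that $$\|x\| \le \kappa ( \|x_1\| + \dots + \|x_n\| )$$ whenever $n\in\mathbb{N}$, $x, x_1,\dots, x_n \in X$, $0 \le t_1 \le t_2 \le \dots \le t_n \le t$ and $$T(t) x = T(t_1) x_1 + \dots + T(t_n) x_n.$$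
   Context: All Banach spaces are complex. An operator $B$ on a Banach space is dissipative if $\|(\lambda - B)x\|\ge\lambda\|x\|$ for all $\lambda>0$, $x\in D(B)$. $X$ is isomorphically embedded in $Y$ if there is a linear map $X\to Y$ that is an isomorphism (bounded with bounded inverse) onto a closed subspace of $Y$. $Z \supseteq X$ means that $X$ is a closed subspace of $Z$ with the same norm (up to identification via a linear isometric embedding of $X$ into $Z$). A $C_0$-group $S$ on $Z\supseteq X$ is a $C_0$-group extension of $T$ on $Z$ if $X$ is invariant under $S(t)$ and $T(t)=S(t)|_X$ for all $t\ge0$. *)

theory Defs
  imports "HOL-Analysis.Analysis" "HOL-Library.Function_Algebras"
begin

section \<open>Complex vector spaces and complex Banach spaces\<close>

class complex_vector = ab_group_add +
  fixes scaleC :: "complex \<Rightarrow> 'a \<Rightarrow> 'a" (infixr "*\<^sub>C" 75)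
  assumes scaleC_add_right: "a *\<^sub>C (x + y) = a *\<^sub>C x + a *\<^sub>C y"
    and scaleC_add_left: "(a + b) *\<^sub>C x = a *\<^sub>C x + b *\<^sub>C x"
    and scaleC_scaleC: "a *\<^sub>C (b *\<^sub>C x) = (a * b) *\<^sub>C x"
    and scaleC_one: "1 *\<^sub>C x = x"

global_interpretation cvec: vector_space "scaleC :: complex \<Rightarrow> 'a \<Rightarrow> 'a::complex_vector"
  by standard (simp_all add: scaleC_add_right scaleC_add_left scaleC_scaleC scaleC_one)

class complex_banach = complex_vector + banach +
  assumes scaleR_scaleC: "r *\<^sub>R x = complex_of_real r *\<^sub>C x"
    and norm_scaleC: "norm (a *\<^sub>C x) = cmod a * norm x"

instantiation complex :: complex_banach
begin
definition scaleC_complex_def: "a *\<^sub>C (z::complex) = a * z"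
instance
  by standard (simp_all add: scaleC_complex_def algebra_simps norm_mult scaleR_conv_of_real)
end

instantiation "fun" :: (type, complex_vector) complex_vector
begin
definition scaleC_fun_def: "a *\<^sub>C f = (\<lambda>i. a *\<^sub>C f i)"
instance
  by standard
    (simp_all add: scaleC_fun_def fun_eq_iff scaleC_add_right scaleC_add_left
      scaleC_scaleC scaleC_one)
end

text \<open>Spaces over which one has to quantify existentially cannot be types. They are represented
  as pairs \<open>(V, N)\<close> of a complex linear subspace \<open>V\<close> of an ambient complex vector space and a
  function \<open>N\<close> that is a norm on \<open>V\<close>; the values of \<open>N\<close>, and of operators, outside \<open>V\<close> are
  irrelevant. A type \<open>'a::complex_banach\<close> is itself the pair \<open>(UNIV, norm)\<close>.\<close>

definition complex_norm_on :: "'a::complex_vector set \<Rightarrow> ('a \<Rightarrow> real) \<Rightarrow> bool" where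
  "complex_norm_on V N \<longleftrightarrow>
     cvec.subspace V \<and>
     (\<forall>x\<in>V. 0 \<le> N x \<and> (N x = 0 \<longleftrightarrow> x = 0)) \<and>
     (\<forall>x\<in>V. \<forall>y\<in>V. N (x + y) \<le> N x + N y) \<and>
     (\<forall>a. \<forall>x\<in>V. N (a *\<^sub>C x) = cmod a * N x)"

definition complex_banach_on :: "'a::complex_vector set \<Rightarrow> ('a \<Rightarrow> real) \<Rightarrow> bool" where
  "complex_banach_on V N \<longleftrightarrow>
     complex_norm_on V N \<and>
     (\<forall>f::nat \<Rightarrow> 'a. range f \<subseteq> V \<and> (\<forall>e>0. \<exists>M. \<forall>m\<ge>M. \<forall>n\<ge>M. N (f m - f n) < e) \<longrightarrow>
        (\<exists>x\<in>V. (\<lambda>n. N (f n - x)) \<longlonglongrightarrow> 0))"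

definition closed_csubspace_on ::
  "'a::complex_vector set \<Rightarrow> ('a \<Rightarrow> real) \<Rightarrow> 'a set \<Rightarrow> bool" where
  "closed_csubspace_on V N W \<longleftrightarrow>
     cvec.subspace W \<and> W \<subseteq> V \<and>
     (\<forall>(f::nat \<Rightarrow> 'a) x. range f \<subseteq> W \<and> x \<in> V \<and> (\<lambda>n. N (f n - x)) \<longlonglongrightarrow> 0 \<longrightarrow> x \<in> W)"

definition equivalent_norm :: "('a::complex_banach \<Rightarrow> real) \<Rightarrow> bool" where
  "equivalent_norm N \<longleftrightarrow>
     complex_norm_on UNIV N \<and>
     (\<exists>c>0. \<exists>C>0. \<forall>x. c * norm x \<le> N x \<and> N x \<le> C * norm x)"


section \<open>Bounded operators and embeddings\<close>

definition bounded_clinear_on ::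
  "'a::complex_vector set \<Rightarrow> ('a \<Rightarrow> real) \<Rightarrow> 'b::complex_vector set \<Rightarrow> ('b \<Rightarrow> real) \<Rightarrow>
    ('a \<Rightarrow> 'b) \<Rightarrow> bool" where
  "bounded_clinear_on V N W M f \<longleftrightarrow>
     f ` V \<subseteq> W \<and>
     (\<forall>x\<in>V. \<forall>y\<in>V. f (x + y) = f x + f y) \<and>
     (\<forall>a. \<forall>x\<in>V. f (a *\<^sub>C x) = a *\<^sub>C f x) \<and>
     (\<exists>K. \<forall>x\<in>V. M (f x) \<le> K * N x)"

text \<open>As for \<^const>\<open>onorm\<close>, the convention \<open>0 / 0 = 0\<close> makes \<open>x = 0\<close> harmless and gives the
  operator norm \<open>0\<close> on the zero space.\<close>

definition op_norm_on :: "'a::complex_vector set \<Rightarrow> ('a \<Rightarrow> real) \<Rightarrow> ('a \<Rightarrow> 'a) \<Rightarrow> real" where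
  "op_norm_on V N f = (SUP x\<in>V. N (f x) / N x)"

definition isomorphic_embedding ::
  "'y::complex_vector set \<Rightarrow> ('y \<Rightarrow> real) \<Rightarrow> ('a::complex_banach \<Rightarrow> 'y) \<Rightarrow> bool" where
  "isomorphic_embedding V N J \<longleftrightarrow>
     closed_csubspace_on V N (range J) \<and> inj J \<and>
     bounded_clinear_on UNIV norm (range J) N J \<and>
     bounded_clinear_on (range J) N UNIV norm (inv J)"

definition isometric_embedding ::
  "'z::complex_vector set \<Rightarrow> ('z \<Rightarrow> real) \<Rightarrow> ('a::complex_banach \<Rightarrow> 'z) \<Rightarrow> bool" where
  "isometric_embedding V N J \<longleftrightarrow>
     closed_csubspace_on V N (range J) \<and>
     bounded_clinear_on UNIV norm (range J) N J \<and>
     (\<forall>x. N (J x) = norm x)"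


section \<open>Semigroups, groups, generators\<close>

definition C0_semigroup_on ::
  "'a::complex_vector set \<Rightarrow> ('a \<Rightarrow> real) \<Rightarrow> (real \<Rightarrow> 'a \<Rightarrow> 'a) \<Rightarrow> bool" where
  "C0_semigroup_on V N T \<longleftrightarrow>
     (\<forall>t\<ge>0. bounded_clinear_on V N V N (T t)) \<and>
     (\<forall>x\<in>V. T 0 x = x) \<and>
     (\<forall>s\<ge>0. \<forall>t\<ge>0. \<forall>x\<in>V. T (s + t) x = T s (T t x)) \<and>
     (\<forall>x\<in>V. ((\<lambda>t. N (T t x - x)) \<longlongrightarrow> 0) (at_right 0))"

definition C0_group_on ::
  "'a::complex_vector set \<Rightarrow> ('a \<Rightarrow> real) \<Rightarrow> (real \<Rightarrow> 'a \<Rightarrow> 'a) \<Rightarrow> bool" where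
  "C0_group_on V N S \<longleftrightarrow>
     (\<forall>t. bounded_clinear_on V N V N (S t)) \<and>
     (\<forall>x\<in>V. S 0 x = x) \<and>
     (\<forall>s t. \<forall>x\<in>V. S (s + t) x = S s (S t x)) \<and>
     (\<forall>x\<in>V. ((\<lambda>t. N (S t x - x)) \<longlongrightarrow> 0) (at 0))"

definition generator_dom :: "(real \<Rightarrow> 'a \<Rightarrow> 'a) \<Rightarrow> 'a::complex_banach set" where
  "generator_dom T = {x. \<exists>y. ((\<lambda>h. (T h x - x) /\<^sub>R h) \<longlongrightarrow> y) (at_right 0)}"

definition generator :: "(real \<Rightarrow> 'a \<Rightarrow> 'a) \<Rightarrow> 'a \<Rightarrow> 'a::complex_banach" where
  "generator T x = Lim (at_right 0) (\<lambda>h. (T h x - x) /\<^sub>R h)"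

text \<open>An unbounded operator is given by its domain \<open>D\<close> and a function \<open>B\<close> that matters on \<open>D\<close>
  only. The norm \<open>N\<close> is a parameter because it need not be the norm of the type.\<close>

definition dissipative ::
  "('a::complex_banach \<Rightarrow> real) \<Rightarrow> 'a set \<Rightarrow> ('a \<Rightarrow> 'a) \<Rightarrow> bool" where
  "dissipative N D B \<longleftrightarrow> (\<forall>r>0. \<forall>x\<in>D. N (r *\<^sub>R x - B x) \<ge> r * N x)"

definition C0_group_extension ::
  "'z::complex_vector set \<Rightarrow> ('z \<Rightarrow> real) \<Rightarrow> ('a::complex_banach \<Rightarrow> 'z) \<Rightarrow>
    (real \<Rightarrow> 'a \<Rightarrow> 'a) \<Rightarrow> (real \<Rightarrow> 'z \<Rightarrow> 'z) \<Rightarrow> bool" where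
  "C0_group_extension V N J T S \<longleftrightarrow>
     C0_group_on V N S \<and>
     (\<forall>t\<ge>0. S t ` range J \<subseteq> range J \<and> (\<forall>x. S t (J x) = J (T t x)))"


section \<open>The four conditions\<close>

definition dissipative_renorming :: "(real \<Rightarrow> 'a \<Rightarrow> 'a::complex_banach) \<Rightarrow> bool" where
  "dissipative_renorming T \<longleftrightarrow>
     (\<exists>N. equivalent_norm N \<and> dissipative N (generator_dom T) (\<lambda>x. - generator T x))"

text \<open>In the next two definitions the type argument fixes the ambient vector space in which the
  larger Banach space is sought. The function space \<open>real \<Rightarrow> 'a\<close> suffices: one may replace the larger
  space by the closed linear span of the sets \<open>S t ` range J\<close>, whose Hamel dimension is at most that
  of \<open>real \<Rightarrow> 'a\<close>.\<close>

definition embeds_in_backward_contractive_group ::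
  "'y::complex_vector itself \<Rightarrow> (real \<Rightarrow> 'a \<Rightarrow> 'a::complex_banach) \<Rightarrow> bool" where
  "embeds_in_backward_contractive_group _ T \<longleftrightarrow>
     (\<exists>(V::'y set) N J S.
        complex_banach_on V N \<and> isomorphic_embedding V N J \<and> C0_group_on V N S \<and>
        (\<forall>t>0. op_norm_on V N (S (- t)) \<le> 1) \<and>
        (\<forall>x. \<forall>t>0. S t (J x) = J (T t x)))"

definition extends_to_backward_bounded_group ::
  "'z::complex_vector itself \<Rightarrow> (real \<Rightarrow> 'a \<Rightarrow> 'a::complex_banach) \<Rightarrow> bool" where
  "extends_to_backward_bounded_group _ T \<longleftrightarrow>
     (\<exists>(V::'z set) N J S \<kappa>.
        complex_banach_on V N \<and> isometric_embedding V N J \<and> C0_group_extension V N J T S \<and>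
        (\<forall>t\<ge>0. op_norm_on V N (S (- t)) \<le> \<kappa>))"

definition finite_sum_lower_bound :: "(real \<Rightarrow> 'a \<Rightarrow> 'a::complex_banach) \<Rightarrow> bool" where
  "finite_sum_lower_bound T \<longleftrightarrow>
     (\<exists>\<kappa>::real. \<forall>(n::nat) x (xs :: nat \<Rightarrow> 'a) (ts :: nat \<Rightarrow> real) t.
        1 \<le> n \<and>
        (\<forall>i\<in>{1..n}. 0 \<le> ts i \<and> ts i \<le> t) \<and>
        (\<forall>i\<in>{1..n}. \<forall>j\<in>{1..n}. i \<le> j \<longrightarrow> ts i \<le> ts j) \<and>
        T t x = (\<Sum>i=1..n. T (ts i) (xs i))
        \<longrightarrow> norm x \<le> \<kappa> * (\<Sum>i=1..n. norm (xs i)))"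

end

theory Submission
  imports Defs
begin

text \<open>The theorem rests on one reformulation of (i): \<open>-A\<close> is dissipative for an equivalent norm \<open>N\<close> if and
only if \<open>T\<close> is expanding for \<open>N\<close>, that is \<open>N x \<le> N (T t x)\<close> for all \<open>t \<ge> 0\<close>
(\<open>dissipative_renorming_iff_expanding\<close>). For \<open>x\<close> in the domain of the generator, dissipativity bounds
the lower right Dini derivative of \<open>t \<mapsto> N (T t x)\<close> from below by \<open>0\<close>, and the domain is dense.
Conversely \<open>h \<mapsto> N (x + h A x)\<close> is convex, and its right derivative at \<open>0\<close> is that of \<open>h \<mapsto> N (T h x)\<close>,
hence nonnegative.

A group extension \<open>S\<close> with bounded negative part gives an expanding norm,
\<open>x \<mapsto> sup {N (S (-t) (J x)) | t \<ge> 0}\<close>; if the negative part is contractive, the supremum is \<open>N (J x)\<close>.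
This proves that (ii) and (iii) imply (i). An expanding norm also gives (iv): in
\<open>T t x = y + T a x\<^sub>1 + \<dots>\<close> with smallest time \<open>a\<close>, everything except \<open>y\<close> can be collected into a
single \<open>T a z\<close>, so \<open>y = T a z\<close> and \<open>N z \<le> N y\<close>; then \<open>T a\<close> cancels and one term fewer
remains (\<open>expanding_sum_bound\<close>).

The heart is the construction of a group from (iv). A function \<open>f :: real \<Rightarrow> 'a\<close> is read as the formal
sum of the \<open>S r (f r)\<close>. Such sums form a weighted \<open>\<ell>\<^sup>1\<close> space, on which \<open>S t\<close> is translation by \<open>t\<close>.
The semigroup imposes relations: a finitely supported \<open>k\<close> has to vanish if
\<open>T t\<close> applied to it, the sum of the \<open>T (t + r) (k r)\<close>, is \<open>0\<close> for large \<open>t\<close>. The quotient by the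
relations carries a \<open>C\<^sub>0\<close>-group that extends \<open>T\<close> (\<open>group_from_weight\<close>), and condition (iv) says exactly
that the quotient norm of the point mass \<open>x\<close> at time \<open>0\<close> is at least a multiple of \<open>\<parallel>x\<parallel>\<close>. The weight
decides what more one gets: with \<open>M exp (\<omega> max r 0)\<close>, where \<open>M exp (\<omega> t)\<close> bounds \<open>T t\<close>, backward
translations are contractions, which is (ii); with a large multiple of it for \<open>r \<noteq> 0\<close> and weight
\<open>1\<close> at \<open>r = 0\<close>, the embedding is isometric, which is (iii).

The quotient has to be a subspace of \<open>real \<Rightarrow> 'a\<close>. It is realised on a linear complement of the null
space of the quotient seminorm (\<open>seminormed_space_quotient\<close>).\<close>

section \<open>The uniform boundedness principle\<close>

text \<open>If the open sets \<open>U n\<close> of points at which some member of \<open>F\<close> exceeds \<open>n\<close> were all dense, Baire's theorem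
would give a point in all of them, against pointwise boundedness. So some \<open>U n\<close> misses a ball, and on
this ball \<open>F\<close> is uniformly bounded.\<close>

lemma pointwise_bounded_imp_uniformly_bounded:
  fixes F :: "('a::banach \<Rightarrow> 'b::real_normed_vector) set"
  assumes lin: "\<And>f. f \<in> F \<Longrightarrow> bounded_linear f"
    and ptw: "\<And>x. \<exists>B. \<forall>f\<in>F. norm (f x) \<le> B"
  shows "\<exists>M. \<forall>f\<in>F. \<forall>x. norm (f x) \<le> M * norm x"
proof -
  define U where "U n = (\<Union>f\<in>F. {x. real n < norm (f x)})" for n
  have U_open: "open (U n)" for n
    unfolding U_def
    by (intro open_UN ballI open_Collect_less continuous_intros
        linear_continuous_on lin) auto
  have U_inter: "(\<Inter>n. U n) = {}"
  proof -
    have "\<exists>n. x \<notin> U n" for x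
    proof -
      obtain B where B: "\<forall>f\<in>F. norm (f x) \<le> B" using ptw by blast
      obtain n where "B \<le> real n" using real_arch_simple by blast
      with B have "x \<notin> U n" unfolding U_def by force
      then show ?thesis by blast
    qed
    then show ?thesis by blast
  qed
  have "\<exists>n. closure (U n) \<noteq> UNIV"
  proof (rule ccontr)
    assume "\<nexists>n. closure (U n) \<noteq> UNIV"
    then have dense: "closure (U n) = UNIV" for n by blast
    have "Met_TC.mtopology closure_of (\<Inter>(range U)) = (UNIV :: 'a set)"
      by (rule Met_TC.metric_Baire_category)
        (use U_open dense complete_UNIV in auto)
    then show False using U_inter by simp
  qed
  then obtain n y where "y \<notin> closure (U n)" by blast
  then obtain r where "r > 0" "ball y r \<subseteq> - closure (U n)"
    using open_contains_ball[of "- closure (U n)"] by auto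
  then have r: "r > 0" "ball y r \<inter> U n = {}"
    using closure_subset[of "U n"] by auto
  have bound: "norm (f z) \<le> real n" if "f \<in> F" "dist y z < r" for f z
  proof -
    have "z \<notin> U n" using r(2) that(2) by (auto simp: ball_def)
    then show ?thesis using that(1) unfolding U_def by (auto simp: not_less)
  qed
  have "norm (f x) \<le> (4 * real n / r) * norm x" if f: "f \<in> F" for f x
  proof (cases "x = 0")
    case True
    interpret bounded_linear f using lin f .
    show ?thesis using True by (simp add: zero)
  next
    case False
    interpret bounded_linear f using lin f .
    \<comment> \<open>scales \<open>x\<close> to norm \<open>r / 2\<close>, so that \<open>y + c x\<close> stays in the ball of radius \<open>r\<close>\<close>
    define c where "c = r / (2 * norm x)"
    have c: "c > 0" using False r(1) by (simp add: c_def)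
    have "norm (c *\<^sub>R x) = r / 2"
      using False r(1) by (simp add: c_def)
    then have "norm (f (y + c *\<^sub>R x)) \<le> real n" "norm (f y) \<le> real n"
      using bound[OF f, of "y + c *\<^sub>R x"] bound[OF f, of y] r(1) by (auto simp: dist_norm)
    moreover have "f (y + c *\<^sub>R x) = f y + c *\<^sub>R f x" by (simp add: add scale)
    ultimately have "norm (c *\<^sub>R f x) \<le> 2 * real n"
      by (metis add_diff_cancel_left' add_mono mult_2 norm_triangle_ineq4 order_trans)
    then have "c * norm (f x) \<le> 2 * real n" using c by simp
    then have "norm (f x) \<le> 2 * real n / c" using c by (simp add: field_simps)
    also have "\<dots> = (4 * real n / r) * norm x" using False r(1) by (simp add: c_def)
    finally show ?thesis .
  qed
  then show ?thesis by blast
qed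

section \<open>Strongly continuous semigroups\<close>

lemma bounded_clinear_on_UNIV_bounded_linear:
  fixes f :: "'a::complex_banach \<Rightarrow> 'b::complex_banach"
  assumes "bounded_clinear_on UNIV norm UNIV norm f"
  shows "bounded_linear f"
proof -
  obtain K where K: "\<And>x. norm (f x) \<le> K * norm x"
    and *: "\<And>x y. f (x + y) = f x + f y" "\<And>a x. f (a *\<^sub>C x) = a *\<^sub>C f x"
    using assms unfolding bounded_clinear_on_def by auto
  show ?thesis
    by (rule bounded_linear_intro[of f K])
      (use K * in \<open>auto simp: scaleR_scaleC mult.commute\<close>)
qed

locale C0_semigroup =
  fixes T :: "real \<Rightarrow> 'a \<Rightarrow> 'a::complex_banach"
  assumes C0: "C0_semigroup_on UNIV norm T"
begin

lemma bounded_clinear: "0 \<le> t \<Longrightarrow> bounded_clinear_on UNIV norm UNIV norm (T t)"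
  using C0 unfolding C0_semigroup_on_def by blast

lemma bounded_linear: "0 \<le> t \<Longrightarrow> bounded_linear (T t)"
  using bounded_clinear bounded_clinear_on_UNIV_bounded_linear by blast

lemma T_0 [simp]: "T 0 x = x"
  using C0 unfolding C0_semigroup_on_def by auto

lemma T_add: "0 \<le> s \<Longrightarrow> 0 \<le> t \<Longrightarrow> T (s + t) x = T s (T t x)"
  using C0 unfolding C0_semigroup_on_def by auto

lemma T_scaleC: "0 \<le> t \<Longrightarrow> T t (a *\<^sub>C x) = a *\<^sub>C T t x"
  using bounded_clinear unfolding bounded_clinear_on_def by auto

lemmas T_linear = bounded_linear.linear[OF bounded_linear]
lemmas T_plus = linear_add[OF T_linear]
  and T_diff = linear_diff[OF T_linear]
  and T_sum = linear_sum[OF T_linear]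
  and T_zero = linear_0[OF T_linear]
  and T_scaleR = linear_cmul[OF T_linear]

lemma T_tendsto_at_0: "((\<lambda>t. T t x) \<longlongrightarrow> x) (at_right 0)"
  using C0 unfolding C0_semigroup_on_def
  by (subst Lim_null, subst tendsto_norm_zero_iff[symmetric]) auto

text \<open>Otherwise there are times tending to \<open>0\<close> at which the operator norms are unbounded, although the orbits
along these times converge.\<close>

lemma bounded_near_0: "\<exists>\<delta>>0. \<exists>M. \<forall>t\<in>{0..\<delta>}. \<forall>x. norm (T t x) \<le> M * norm x"
proof (rule ccontr)
  assume neg: "\<not> ?thesis"
  have "\<exists>t. 0 \<le> t \<and> t \<le> 1 / real (Suc n) \<and> \<not> (\<forall>x. norm (T t x) \<le> real (Suc n) * norm x)" for n
  proof -
    have "\<not> (\<forall>t\<in>{0..1 / real (Suc n)}. \<forall>x. norm (T t x) \<le> real (Suc n) * norm x)"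
      using neg by (metis of_nat_0_less_iff zero_less_Suc zero_less_divide_1_iff)
    then show ?thesis by auto
  qed
  then obtain \<tau> where \<tau>: "\<And>n. 0 \<le> \<tau> n" "\<And>n. \<tau> n \<le> 1 / real (Suc n)"
    "\<And>n. \<exists>x. real (Suc n) * norm x < norm (T (\<tau> n) x)"
    unfolding not_all not_le by metis
  \<comment> \<open>\<open>T 0\<close> is the identity and never violates the bound\<close>
  have \<tau>_pos: "\<tau> n > 0" for n
  proof -
    have "\<tau> n \<noteq> 0"
    proof
      assume "\<tau> n = 0"
      then obtain x :: 'a where "real (Suc n) * norm x < norm x" using \<tau>(3)[of n] by (metis T_0)
      moreover have "1 * norm x \<le> real (Suc n) * norm x" by (intro mult_right_mono) auto
      ultimately show False by simp
    qed
    with \<tau>(1)[of n] show ?thesis by linarith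
  qed
  have "\<tau> \<longlonglongrightarrow> 0"
    by (rule tendsto_sandwich[of "\<lambda>_. 0" _ _ "\<lambda>n. 1 / real (Suc n)"])
      (use \<tau> LIMSEQ_inverse_real_of_nat in \<open>auto simp: inverse_eq_divide\<close>)
  then have \<tau>_lim: "filterlim \<tau> (at_right 0) sequentially"
    by (rule tendsto_imp_filterlim_at_right) (simp add: \<tau>_pos)
  have "\<exists>B. \<forall>f\<in>range (\<lambda>n. T (\<tau> n)). norm (f x) \<le> B" for x
  proof -
    have "(\<lambda>n. T (\<tau> n) x) \<longlonglongrightarrow> x"
      using filterlim_compose[OF T_tendsto_at_0 \<tau>_lim] .
    then have "Bseq (\<lambda>n. T (\<tau> n) x)" by (intro convergent_imp_Bseq convergentI)
    then show ?thesis unfolding Bseq_def by auto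
  qed
  moreover have "bounded_linear f" if "f \<in> range (\<lambda>n. T (\<tau> n))" for f
    using that bounded_linear \<tau>(1) by auto
  ultimately obtain M where M: "\<And>n x. norm (T (\<tau> n) x) \<le> M * norm x"
    using pointwise_bounded_imp_uniformly_bounded[of "range (\<lambda>n. T (\<tau> n))"]
    by (metis rangeI)
  obtain n where "M \<le> real n" using real_arch_simple by blast
  then have "M \<le> real (Suc n)" by simp
  moreover obtain x where "real (Suc n) * norm x < norm (T (\<tau> n) x)" using \<tau>(3) by blast
  ultimately show False
    using M[of n x] mult_right_mono[of M "real (Suc n)" "norm x"] by auto
qed

text \<open>Writing \<open>t = n \<delta> + s\<close> with \<open>0 \<le> s \<le> \<delta>\<close> and a bound \<open>M \<ge> 1\<close> for the semigroup on \<open>[0, \<delta>]\<close>, one gets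
\<open>M\<close> to the power \<open>n + 1\<close> as a bound for \<open>T t\<close>; this is at most \<open>M exp (\<omega> t)\<close> for \<open>\<omega> = ln M / \<delta>\<close>.\<close>

lemma exponentially_bounded:
  obtains M \<omega> where "M \<ge> 1" "\<omega> \<ge> 0"
    "\<And>t x. 0 \<le> t \<Longrightarrow> norm (T t x) \<le> M * exp (\<omega> * t) * norm x"
proof -
  obtain \<delta> M0 where \<delta>: "\<delta> > 0" and M0: "\<And>t x. 0 \<le> t \<Longrightarrow> t \<le> \<delta> \<Longrightarrow> norm (T t x) \<le> M0 * norm x"
    using bounded_near_0 by (meson atLeastAtMost_iff)
  define M where "M = max 1 M0"
  have M: "norm (T t x) \<le> M * norm x" if "0 \<le> t" "t \<le> \<delta>" for t x
    using M0[OF that, of x] mult_right_mono[of M0 M "norm x"] by (simp add: M_def)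
  have M1: "M \<ge> 1" by (simp add: M_def)
  have pow: "norm (T (real n * \<delta> + s) x) \<le> M ^ Suc n * norm x" if "0 \<le> s" "s \<le> \<delta>" for n s x
  proof (induction n)
    case 0
    show ?case using M[OF that] by simp
  next
    case (Suc n)
    have "real (Suc n) * \<delta> + s = \<delta> + (real n * \<delta> + s)" by (simp add: algebra_simps)
    moreover have "T (\<delta> + (real n * \<delta> + s)) x = T \<delta> (T (real n * \<delta> + s) x)"
      using \<delta> that by (intro T_add) auto
    ultimately have "T (real (Suc n) * \<delta> + s) x = T \<delta> (T (real n * \<delta> + s) x)"
      by (simp only:)
    also have "norm \<dots> \<le> M * norm (T (real n * \<delta> + s) x)" using M \<delta> by simp
    also have "\<dots> \<le> M * (M ^ Suc n * norm x)" using Suc M1 by (intro mult_left_mono) auto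
    finally show ?case by (simp add: mult.assoc)
  qed
  define \<omega> where "\<omega> = ln M / \<delta>"
  have \<omega>: "\<omega> \<ge> 0" using M1 \<delta> by (simp add: \<omega>_def)
  have "norm (T t x) \<le> M * exp (\<omega> * t) * norm x" if t: "0 \<le> t" for t x
  proof -
    define n where "n = nat \<lfloor>t / \<delta>\<rfloor>"
    have n_floor: "real n = of_int \<lfloor>t / \<delta>\<rfloor>" using t \<delta> by (simp add: n_def)
    have n: "real n * \<delta> \<le> t" "t \<le> real n * \<delta> + \<delta>"
    proof -
      have "real n \<le> t / \<delta>" "t / \<delta> \<le> real n + 1" unfolding n_floor by linarith+
      then show "real n * \<delta> \<le> t" "t \<le> real n * \<delta> + \<delta>" using \<delta> by (simp_all add: field_simps)
    qed
    have "norm (T (real n * \<delta> + (t - real n * \<delta>)) x) \<le> M ^ Suc n * norm x"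
      by (rule pow) (use n in linarith)+
    then have "norm (T t x) \<le> M * M ^ n * norm x" by simp
    also have "M ^ n = exp (\<omega> * (real n * \<delta>))"
      using M1 \<delta> by (simp add: \<omega>_def exp_of_nat_mult mult.commute)
    also have "M * exp (\<omega> * (real n * \<delta>)) * norm x \<le> M * exp (\<omega> * t) * norm x"
      using n \<omega> M1 by (intro mult_right_mono mult_left_mono) (auto intro: mult_left_mono)
    finally show ?thesis .
  qed
  with M1 \<omega> that show ?thesis by blast
qed

text \<open>Both one-sided limits reduce to continuity at \<open>0\<close>, because the difference of two orbit points is
\<open>T s (T (t - s) x - x)\<close> for the smaller time \<open>s\<close>, and \<open>T s\<close> is bounded locally uniformly in \<open>s\<close>.\<close>

lemma continuous_on_orbit: "continuous_on {0..} (\<lambda>t. T t x)"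
proof -
  obtain M \<omega> where M: "M \<ge> 1" "\<omega> \<ge> 0"
    and bd: "\<And>t x. 0 \<le> t \<Longrightarrow> norm (T t x) \<le> M * exp (\<omega> * t) * norm x"
    using exponentially_bounded by blast
  have est: "norm (T t x - T s x) \<le> M * exp (\<omega> * s) * norm (T (t - s) x - x)" 
    if "0 \<le> s" "s \<le> t" for s t
  proof -
    have "T t x - T s x = T s (T (t - s) x - x)"
      using T_add[of s "t - s" x] that by (simp add: T_diff)
    then show ?thesis using bd that by metis
  qed
  show ?thesis
    unfolding continuous_on_iff
  proof (intro ballI allI impI)
    fix t e :: real assume t: "t \<in> {0..}" and e: "e > 0"
    define C where "C = M * exp (\<omega> * (t + 1))"
    have C: "C > 0" using M by (simp add: C_def)
    have "\<forall>\<^sub>F h in at_right 0. dist (T h x) x < e / C"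
      using T_tendsto_at_0 e C by (intro tendstoD) auto
    then obtain d where d: "d > 0" "\<And>h. 0 < h \<Longrightarrow> h < d \<Longrightarrow> dist (T h x) x < e / C"
      unfolding eventually_at_right_field by auto
    have d0: "norm (T h x - x) < e / C" if "0 \<le> h" "h < d" for h
      using d(2)[of h] that e C by (cases "h = 0") (auto simp: dist_norm)
    have key: "norm (T b x - T a x) < e" if "0 \<le> a" "a \<le> b" "b - a < d" "a \<le> t + 1" for a b
    proof -
      have "norm (T b x - T a x) \<le> M * exp (\<omega> * a) * norm (T (b - a) x - x)"
        using est that by simp
      also have "\<dots> \<le> C * norm (T (b - a) x - x)"
        unfolding C_def using that M by (intro mult_right_mono mult_left_mono) (auto intro: mult_left_mono)
      also have "\<dots> < C * (e / C)" using d0[of "b - a"] that C by (intro mult_strict_left_mono) auto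
      finally show ?thesis using C by simp
    qed
    show "\<exists>d>0. \<forall>x'\<in>{0..}. dist x' t < d \<longrightarrow> dist (T x' x) (T t x) < e"
    proof (intro exI[of _ "min d 1"] conjI ballI impI)
      fix s assume s: "s \<in> {0..}" "dist s t < min d 1"
      show "dist (T s x) (T t x) < e"
      proof (cases "s \<le> t")
        case True
        then show ?thesis using key[of s t] s t by (simp add: dist_norm norm_minus_commute)
      next
        case False
        then show ?thesis using key[of t s] s t by (simp add: dist_norm)
      qed
    qed (use d in auto)
  qed
qed

text \<open>The averages \<open>(1 / h) \<integral>\<^sub>0\<^sup>h T s x ds\<close> lie in the domain and converge to \<open>x\<close> as \<open>h \<rightarrow> 0\<close>.\<close>

lemma dense_generator_dom: "closure (generator_dom T) = UNIV"
proof -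
  have "x \<in> closure (generator_dom T)" for x
  proof -
    define F where "F t = integral {0..t} (\<lambda>s. T s x)" for t
    have F_0: "F 0 = 0" by (simp add: F_def)
    have cont: "continuous_on {a..b} (\<lambda>s. T s x)" if "0 \<le> a" for a b
      using continuous_on_subset[OF continuous_on_orbit] that by auto
    have int: "(\<lambda>s. T s x) integrable_on {a..b}" if "0 \<le> a" for a b
      using integrable_continuous_real[OF cont[OF that]] .
    have F_deriv: "((\<lambda>h. (F (t + h) - F t) /\<^sub>R h) \<longlongrightarrow> T t x) (at_right 0)" if t: "0 \<le> t" for t
    proof -
      have "(F has_vector_derivative T t x) (at t within {0..t + 1})"
        unfolding F_def by (rule integral_has_vector_derivative) (use cont t in auto)
      then have "((\<lambda>u. (F u - (F t + (u - t) *\<^sub>R T t x)) /\<^sub>R norm (u - t)) \<longlongrightarrow> 0)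
          (at t within {0..t + 1})"
        by (simp add: has_vector_derivative_def has_derivative_within divide_inverse)
      then have "((\<lambda>u. (F u - (F t + (u - t) *\<^sub>R T t x)) /\<^sub>R norm (u - t)) \<longlongrightarrow> 0)
          (at t within {t..t + 1})"
        by (rule tendsto_within_subset) (use t in auto)
      then have "((\<lambda>u. (F u - (F t + (u - t) *\<^sub>R T t x)) /\<^sub>R norm (u - t)) \<longlongrightarrow> 0) (at_right t)"
        by (simp add: at_within_Icc_at_right)
      then have "((\<lambda>h. (F (h + t) - (F t + h *\<^sub>R T t x)) /\<^sub>R \<bar>h\<bar>) \<longlongrightarrow> 0) (at_right 0)"
        by (subst (asm) filterlim_at_right_to_0) simp
      then have "((\<lambda>h. (F (t + h) - F t) /\<^sub>R h - T t x) \<longlongrightarrow> 0) (at_right 0)"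
        by (rule Lim_transform_eventually)
          (auto simp: eventually_at_right_field algebra_simps intro!: exI[of _ 1])
      then show ?thesis by (rule LIM_zero_cancel)
    qed
    have "(1 / h) *\<^sub>R F h \<in> generator_dom T" if h: "h > 0" for h
    proof -
      have shift: "T e (F h) = F (e + h) - F e" if e: "e \<ge> 0" for e
      proof -
        have "T e (F h) = integral {0..h} (\<lambda>s. T e (T s x))"
          unfolding F_def using integral_linear[OF int bounded_linear[OF e], of 0 h]
          by (simp add: o_def)
        also have "\<dots> = integral {0..h} (\<lambda>s. T (s + e) x)"
          by (rule integral_cong) (use e T_add[of e] in \<open>auto simp: add.commute[of _ e]\<close>)
        also have "\<dots> = integral {e..e + h} (\<lambda>s. T s x)"
          using integral_shift_Icc_real[of 0 h "\<lambda>s. T s x" e] by (simp add: o_def add.commute)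
        also have "\<dots> = F (e + h) - F e"
          unfolding F_def using Henstock_Kurzweil_Integration.integral_combine[of 0 e "e + h" "\<lambda>s. T s x"] e h int
          by (auto simp: algebra_simps)
        finally show ?thesis .
      qed
      have "((\<lambda>e. (T e (F h) - F h) /\<^sub>R e) \<longlongrightarrow> T h x - x) (at_right 0)"
      proof (rule Lim_transform_eventually)
        show "((\<lambda>e. (F (h + e) - F h) /\<^sub>R e - (F (0 + e) - F 0) /\<^sub>R e) \<longlongrightarrow> T h x - x) (at_right 0)"
          using tendsto_diff[OF F_deriv[of h] F_deriv[of 0]] h by simp
        show "\<forall>\<^sub>F e in at_right 0. (F (h + e) - F h) /\<^sub>R e - (F (0 + e) - F 0) /\<^sub>R e
            = (T e (F h) - F h) /\<^sub>R e"
          unfolding eventually_at_right_field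
          by (intro exI[of _ 1]) (auto simp: shift scaleR_diff_right add.commute[of h] F_0)
      qed
      then have "((\<lambda>e. (1 / h) *\<^sub>R ((T e (F h) - F h) /\<^sub>R e))
          \<longlongrightarrow> (1 / h) *\<^sub>R (T h x - x)) (at_right 0)"
        by (intro tendsto_intros)
      then have "((\<lambda>e. (T e ((1 / h) *\<^sub>R F h) - (1 / h) *\<^sub>R F h) /\<^sub>R e)
          \<longlongrightarrow> (1 / h) *\<^sub>R (T h x - x)) (at_right 0)"
      proof (rule Lim_transform_eventually)
        show "\<forall>\<^sub>F e in at_right 0. (1 / h) *\<^sub>R ((T e (F h) - F h) /\<^sub>R e) =
           (T e ((1 / h) *\<^sub>R F h) - (1 / h) *\<^sub>R F h) /\<^sub>R e"
          unfolding eventually_at_right_field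
          by (intro exI[of _ 1]) (auto simp: T_scaleR algebra_simps)
      qed
      then show ?thesis unfolding generator_dom_def by blast
    qed
    moreover have "((\<lambda>h. (1 / h) *\<^sub>R F h) \<longlongrightarrow> x) (at_right 0)"
      using F_deriv[of 0] by (simp add: F_def inverse_eq_divide)
    ultimately show ?thesis
      by (intro Lim_in_closed_set[of "closure (generator_dom T)" "\<lambda>h. (1 / h) *\<^sub>R F h" "at_right 0"])
        (auto simp: eventually_at_right_field intro!: exI[of _ 1] subsetD[OF closure_subset])
  qed
  then show ?thesis by blast
qed

end

section \<open>Seminorms on complex vector spaces\<close>

text \<open>Seminorms are needed besides norms because the group is first constructed on a seminormed space of
formal sums.\<close>

locale complex_seminorm =
  fixes W :: "'v::complex_vector set" and q :: "'v \<Rightarrow> real"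
  assumes subspace_W: "cvec.subspace W"
    and q_nonneg: "f \<in> W \<Longrightarrow> 0 \<le> q f"
    and q_triangle: "f \<in> W \<Longrightarrow> g \<in> W \<Longrightarrow> q (f + g) \<le> q f + q g"
    and q_scaleC: "f \<in> W \<Longrightarrow> q (a *\<^sub>C f) = cmod a * q f"
begin

lemmas W_closed = cvec.subspace_0[OF subspace_W] cvec.subspace_add[OF subspace_W]
  cvec.subspace_diff[OF subspace_W] cvec.subspace_scale[OF subspace_W]
  cvec.subspace_neg[OF subspace_W]

lemma q_0: "q 0 = 0"
  using q_scaleC[of 0 0] W_closed(1) by simp

lemma q_minus: "f \<in> W \<Longrightarrow> q (- f) = q f"
  using q_scaleC[of f "-1"] by simp

lemma q_diff: "f \<in> W \<Longrightarrow> g \<in> W \<Longrightarrow> q (f - g) \<le> q f + q g"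
  using q_triangle[of f "- g"] q_minus[of g] W_closed by simp

lemma q_commute: "f \<in> W \<Longrightarrow> g \<in> W \<Longrightarrow> q (f - g) = q (g - f)"
  using q_minus[of "f - g"] W_closed by simp

lemma q_triangle_via: "f \<in> W \<Longrightarrow> g \<in> W \<Longrightarrow> h \<in> W \<Longrightarrow> q (f - h) \<le> q (f - g) + q (g - h)"
  using q_triangle[of "f - g" "g - h"] W_closed by simp

lemma q_eq_if_null_diff:
  assumes "f \<in> W" "g \<in> W" "q (f - g) = 0"
  shows "q f = q g"
proof -
  have "f - g \<in> W" "g - f \<in> W" "q (g - f) = 0"
    using assms W_closed(3) q_commute[of g f] by auto
  then show ?thesis
    using q_triangle[of "f - g" g] q_triangle[of "g - f" f] assms by simp
qed

end

locale complex_norm =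
  fixes V :: "'v::complex_vector set" and N :: "'v \<Rightarrow> real"
  assumes norm_on: "complex_norm_on V N"
begin

sublocale complex_seminorm V N
  using norm_on unfolding complex_norm_on_def by unfold_locales blast+

lemma eq_0: "x \<in> V \<Longrightarrow> N x = 0 \<longleftrightarrow> x = 0"
  using norm_on unfolding complex_norm_on_def by blast

end

lemma equivalent_norm_tendsto_0_iff:
  assumes "equivalent_norm N"
  shows "((\<lambda>x. N (f x)) \<longlongrightarrow> 0) F \<longleftrightarrow> (f \<longlongrightarrow> 0) F"
proof -
  obtain c C where c: "c > 0" "C > 0" and b: "\<And>x. c * norm x \<le> N x" "\<And>x. N x \<le> C * norm x"
    using assms unfolding equivalent_norm_def by blast
  show ?thesis
  proof
    assume "((\<lambda>x. N (f x)) \<longlongrightarrow> 0) F"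
    then have lim: "((\<lambda>x. N (f x) / c) \<longlongrightarrow> 0) F" by (rule tendsto_divide_zero)
    have "\<forall>\<^sub>F x in F. norm (f x) \<le> N (f x) / c"
      using b c by (intro always_eventually) (simp add: field_simps)
    then show "(f \<longlongrightarrow> 0) F" using lim by (rule Lim_null_comparison)
  next
    assume "(f \<longlongrightarrow> 0) F"
    then have lim: "((\<lambda>x. C * norm (f x)) \<longlongrightarrow> 0) F"
      by (intro tendsto_mult_right_zero tendsto_norm_zero)
    have "\<forall>\<^sub>F x in F. norm (N (f x)) \<le> C * norm (f x)"
    proof (intro always_eventually allI)
      fix x
      have "0 \<le> N (f x)"
        using b(1)[of "f x"] c by (meson less_imp_le mult_nonneg_nonneg norm_ge_zero order_trans)
      then show "norm (N (f x)) \<le> C * norm (f x)" using b(2) by simp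
    qed
    then show "((\<lambda>x. N (f x)) \<longlongrightarrow> 0) F" using lim by (rule Lim_null_comparison)
  qed
qed

lemma equivalent_norm_complex_norm: "equivalent_norm N \<Longrightarrow> complex_norm UNIV N"
  unfolding equivalent_norm_def complex_norm_def by blast

lemma complex_norm_on_UNIV_scaleR:
  assumes "complex_norm UNIV N"
  shows "N (r *\<^sub>R x) = \<bar>r\<bar> * N (x :: 'a::complex_banach)"
proof -
  interpret complex_norm UNIV N by fact
  show ?thesis using q_scaleC[of x "complex_of_real r"] by (simp add: scaleR_scaleC)
qed

lemma equivalent_norm_continuous:
  assumes N: "equivalent_norm N" and "continuous_on S f"
  shows "continuous_on S (\<lambda>x. N (f x))"
proof -
  interpret complex_norm UNIV N using equivalent_norm_complex_norm[OF N] .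
  have lip: "\<bar>N x - N y\<bar> \<le> N (x - y)" for x y
    using q_triangle[of "x - y" y] q_triangle[of "y - x" x] q_minus[of "x - y"] by simp
  show ?thesis
    unfolding continuous_on_def
  proof
    fix x assume x: "x \<in> S"
    have "(f \<longlongrightarrow> f x) (at x within S)" using assms(2) x unfolding continuous_on_def by blast
    then have "((\<lambda>y. f y - f x) \<longlongrightarrow> 0) (at x within S)" by (rule LIM_zero)
    then have "((\<lambda>y. N (f y - f x)) \<longlongrightarrow> 0) (at x within S)"
      by (rule iffD2[OF equivalent_norm_tendsto_0_iff[OF N]])
    then have "((\<lambda>y. N (f y) - N (f x)) \<longlongrightarrow> 0) (at x within S)"
      by (rule Lim_null_comparison[rotated]) (simp add: lip)
    then show "((\<lambda>y. N (f y)) \<longlongrightarrow> N (f x)) (at x within S)" by (rule LIM_zero_cancel)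
  qed
qed

section \<open>Dissipative and expanding norms\<close>

text \<open>Tilting \<open>u\<close> by \<open>d (t - a)\<close> with small \<open>d > 0\<close> makes the tilted function locally increasing to the
right, so the closed set \<open>G\<close> of times at which it is at least \<open>u a\<close> cannot have a maximum below \<open>b\<close>.\<close>

lemma Dini_nonneg_imp_le:
  fixes u :: "real \<Rightarrow> real"
  assumes ab: "a \<le> b" and cont: "continuous_on {a..b} u"
    and dini: "\<And>t e. a \<le> t \<Longrightarrow> t < b \<Longrightarrow> e > 0 \<Longrightarrow> \<forall>\<^sub>F h in at_right 0. u t - e * h \<le> u (t + h)"
  shows "u a \<le> u b"
proof (rule field_le_epsilon)
  fix e :: real assume e: "e > 0"
  define d where "d = e / (b - a + 1)"
  have d: "d > 0" using e ab by (simp add: d_def)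
  define G where "G = {t\<in>{a..b}. u a \<le> u t + d * (t - a)}"
  have "closed G"
    unfolding G_def by (intro continuous_on_closed_Collect_le continuous_intros cont)
  have aG: "a \<in> G" using ab by (simp add: G_def)
  have bdd: "bdd_above G" unfolding G_def by (auto intro: bdd_aboveI[of _ b])
  define s where "s = Sup G"
  have sG: "s \<in> G" unfolding s_def
    using closed_contains_Sup[OF _ bdd \<open>closed G\<close>] aG by blast
  have "s = b"
  proof (rule ccontr)
    assume "s \<noteq> b"
    with sG have s: "a \<le> s" "s < b" by (auto simp: G_def)
    obtain r where r: "r > 0" "\<And>h. 0 < h \<Longrightarrow> h < r \<Longrightarrow> u s - d * h \<le> u (s + h)"
      using dini[OF s d] unfolding eventually_at_right_field by auto
    define h where "h = min (r / 2) (b - s)"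
    have h: "0 < h" "h < r" "s + h \<le> b" using r(1) s by (auto simp: h_def)
    have "u a \<le> u s + d * (s - a)" using sG by (simp add: G_def)
    also have "\<dots> \<le> u (s + h) + d * (s + h - a)" using r(2)[OF h(1,2)] by (simp add: algebra_simps)
    finally have "s + h \<in> G" using s h by (simp add: G_def)
    then have "s + h \<le> s" unfolding s_def using cSup_upper[OF _ bdd] by blast
    then show False using h by simp
  qed
  with sG have "u a \<le> u b + d * (b - a)" by (simp add: G_def)
  also have "d * (b - a) \<le> e" using e ab by (simp add: d_def field_simps)
  finally show "u a \<le> u b + e" by simp
qed

context C0_semigroup
begin

lemma generator_tendsto:
  assumes "x \<in> generator_dom T"
  shows "((\<lambda>h. (T h x - x) /\<^sub>R h) \<longlongrightarrow> generator T x) (at_right 0)"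
proof -
  obtain y where y: "((\<lambda>h. (T h x - x) /\<^sub>R h) \<longlongrightarrow> y) (at_right 0)"
    using assms unfolding generator_dom_def by blast
  then have "generator T x = y" unfolding generator_def by (intro tendsto_Lim) auto
  with y show ?thesis by simp
qed

lemma generator_commute:
  assumes x: "x \<in> generator_dom T" and t: "0 \<le> t"
  shows "T t x \<in> generator_dom T" "generator T (T t x) = T t (generator T x)"
proof -
  have "((\<lambda>h. T t ((T h x - x) /\<^sub>R h)) \<longlongrightarrow> T t (generator T x)) (at_right 0)"
    using bounded_linear.tendsto[OF bounded_linear[OF t] generator_tendsto[OF x]] .
  then have lim: "((\<lambda>h. (T h (T t x) - T t x) /\<^sub>R h) \<longlongrightarrow> T t (generator T x)) (at_right 0)"
  proof (rule Lim_transform_eventually)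
    have "T t (T h x) = T h (T t x)" if "0 < h" for h
      using T_add[of t h x] T_add[of h t x] t that by (simp add: add.commute)
    then show "\<forall>\<^sub>F h in at_right 0. T t ((T h x - x) /\<^sub>R h) = (T h (T t x) - T t x) /\<^sub>R h"
      using t unfolding eventually_at_right_field
      by (intro exI[of _ 1]) (auto simp: T_scaleR T_diff)
  qed
  show dom: "T t x \<in> generator_dom T" using lim unfolding generator_dom_def by blast
  show "generator T (T t x) = T t (generator T x)"
    using tendsto_unique[OF _ generator_tendsto[OF dom] lim] by simp
qed

text \<open>For \<open>y\<close> in the domain, dissipativity with parameter \<open>1 / h\<close> reads \<open>N y \<le> N (y + h A y)\<close>, and
\<open>y + h A y\<close> differs from \<open>T h y\<close> by \<open>o(h)\<close>. So the orbits in the domain satisfy the Dini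
condition, and density extends the conclusion to all \<open>x\<close>.\<close>

lemma dissipative_imp_expanding:
  assumes N: "equivalent_norm N" and diss: "dissipative N (generator_dom T) (\<lambda>x. - generator T x)"
    and b: "0 \<le> b"
  shows "N x \<le> N (T b x)"
proof -
  interpret complex_norm UNIV N using equivalent_norm_complex_norm[OF N] .
  have dom: "N x \<le> N (T b x)" if x: "x \<in> generator_dom T" for x
  proof -
    have "N (T 0 x) \<le> N (T b x)"
    proof (rule Dini_nonneg_imp_le[OF b])
      show "continuous_on {0..b} (\<lambda>t. N (T t x))"
        by (intro equivalent_norm_continuous[OF N] continuous_on_subset[OF continuous_on_orbit]) auto
      fix t e :: real assume t: "0 \<le> t" and e: "e > 0"
      define y where "y = T t x"
      have y: "y \<in> generator_dom T" unfolding y_def using generator_commute x t by blast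
      have "((\<lambda>h. (T h y - y) /\<^sub>R h - generator T y) \<longlongrightarrow> 0) (at_right 0)"
        using generator_tendsto[OF y] by (rule LIM_zero)
      then have "((\<lambda>h. N ((T h y - y) /\<^sub>R h - generator T y)) \<longlongrightarrow> 0) (at_right 0)"
        by (rule iffD2[OF equivalent_norm_tendsto_0_iff[OF N]])
      then have "\<forall>\<^sub>F h in at_right 0. N ((T h y - y) /\<^sub>R h - generator T y) < e"
        using e by (rule order_tendstoD)
      then show "\<forall>\<^sub>F h in at_right 0. N (T t x) - e * h \<le> N (T (t + h) x)"
        using eventually_at_right_less[of 0]
      proof eventually_elim
        case (elim h)
        have "N y = h * ((1 / h) * N y)" using elim by simp
        also have "(1 / h) * N y \<le> N ((1 / h) *\<^sub>R y - - generator T y)"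
          using diss y elim unfolding dissipative_def by (metis zero_less_divide_1_iff)
        then have "h * ((1 / h) * N y) \<le> h * N ((1 / h) *\<^sub>R y + generator T y)"
          using elim by (intro mult_left_mono) auto
        also have "\<dots> = N (h *\<^sub>R ((1 / h) *\<^sub>R y + generator T y))"
          using complex_norm_on_UNIV_scaleR[OF complex_norm_axioms] elim by simp
        also have "h *\<^sub>R ((1 / h) *\<^sub>R y + generator T y)
            = T h y - h *\<^sub>R ((T h y - y) /\<^sub>R h - generator T y)"
          using elim by (simp add: algebra_simps)
        also have "N \<dots> \<le> N (T h y) + N (h *\<^sub>R ((T h y - y) /\<^sub>R h - generator T y))"
          by (rule q_diff) auto
        also have "N (h *\<^sub>R ((T h y - y) /\<^sub>R h - generator T y)) \<le> h * e"
          using complex_norm_on_UNIV_scaleR[OF complex_norm_axioms] elim by simp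
        finally have "N y \<le> N (T h y) + h * e" by simp
        moreover have "T (t + h) x = T h y"
          unfolding y_def using T_add[of h t x] elim t by (simp add: add.commute)
        ultimately show ?case by (simp add: y_def mult.commute)
      qed
    qed
    then show ?thesis by simp
  qed
  have "closed {x. N x \<le> N (T b x)}"
    by (intro closed_Collect_le equivalent_norm_continuous[OF N] continuous_on_id
        linear_continuous_on bounded_linear b)
  then have "closure (generator_dom T) \<subseteq> {x. N x \<le> N (T b x)}"
    using dom by (intro closure_minimal) auto
  then show ?thesis using dense_generator_dom by blast
qed

text \<open>Since \<open>T h x \<approx> x + h A x\<close>, the vector \<open>(1 / h) T h x\<close> is
\<open>(r x + A x) + (1 / h - r) x\<close> up to an error that tends to \<open>0\<close>. Its norm is at least \<open>(1 / h) N x\<close>,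
and for \<open>h < 1 / r\<close> the triangle inequality turns this into \<open>r N x \<le> N (r x + A x)\<close>.\<close>

lemma expanding_imp_dissipative:
  assumes N: "equivalent_norm N" and expanding: "\<And>t x. 0 \<le> t \<Longrightarrow> N x \<le> N (T t x)"
  shows "dissipative N (generator_dom T) (\<lambda>x. - generator T x)"
  unfolding dissipative_def
proof (intro allI impI ballI)
  interpret complex_norm UNIV N using equivalent_norm_complex_norm[OF N] .
  fix r :: real and x assume r: "r > 0" and x: "x \<in> generator_dom T"
  have "r * N x \<le> N (r *\<^sub>R x + generator T x) + e" if e: "e > 0" for e
  proof -
    have "((\<lambda>h. (T h x - x) /\<^sub>R h - generator T x) \<longlongrightarrow> 0) (at_right 0)"
      using generator_tendsto[OF x] by (rule LIM_zero)
    then have "((\<lambda>h. N ((T h x - x) /\<^sub>R h - generator T x)) \<longlongrightarrow> 0) (at_right 0)"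
      by (rule iffD2[OF equivalent_norm_tendsto_0_iff[OF N]])
    then have "\<forall>\<^sub>F h in at_right 0. N ((T h x - x) /\<^sub>R h - generator T x) < e"
      using e by (rule order_tendstoD)
    moreover have "\<forall>\<^sub>F h in at_right 0. h < 1 / r"
      using r unfolding eventually_at_right_field by (intro exI[of _ "1 / r"]) auto
    ultimately have "\<forall>\<^sub>F h::real in at_right 0. r * N x \<le> N (r *\<^sub>R x + generator T x) + e"
      using eventually_at_right_less[of "0::real"]
    proof eventually_elim
      case (elim h)
      define d where "d = (T h x - x) /\<^sub>R h - generator T x"
      have hr: "1 / h - r \<ge> 0" using elim r by (simp add: field_simps)
      have "(1 / h) * N x \<le> (1 / h) * N (T h x)"
        using expanding[of h x] elim by (intro mult_left_mono) auto
      also have "\<dots> = N ((1 / h) *\<^sub>R T h x)"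
        using complex_norm_on_UNIV_scaleR[OF complex_norm_axioms] elim by simp
      also have "(1 / h) *\<^sub>R T h x = ((r *\<^sub>R x + generator T x) + d) + (1 / h - r) *\<^sub>R x"
        by (simp add: d_def algebra_simps inverse_eq_divide)
      also have "N \<dots> \<le> (N (r *\<^sub>R x + generator T x) + N d) + N ((1 / h - r) *\<^sub>R x)"
        using q_triangle by (meson UNIV_I add_right_mono order_trans)
      also have "N ((1 / h - r) *\<^sub>R x) = (1 / h - r) * N x"
        using complex_norm_on_UNIV_scaleR[OF complex_norm_axioms] hr by simp
      finally show ?case using elim by (simp add: d_def algebra_simps)
    qed
    then show ?thesis by (simp add: eventually_const_iff)
  qed
  then have "r * N x \<le> N (r *\<^sub>R x + generator T x)" by (rule field_le_epsilon)
  then show "r * N x \<le> N (r *\<^sub>R x - - generator T x)" by simp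
qed

theorem dissipative_renorming_iff_expanding:
  "dissipative_renorming T \<longleftrightarrow> (\<exists>N. equivalent_norm N \<and> (\<forall>t\<ge>0. \<forall>x. N x \<le> N (T t x)))"
  unfolding dissipative_renorming_def
  using dissipative_imp_expanding expanding_imp_dissipative by blast

text \<open>The additional summand \<open>y\<close> outside of all \<open>T (ts i)\<close> makes the induction work: once the smallest time
\<open>a = ts 0\<close> is cancelled, \<open>z + xs 0\<close> takes its place, and \<open>N z \<le> N y\<close> because \<open>T a z = y\<close>.\<close>

lemma expanding_sum_bound:
  fixes n :: nat and xs :: "nat \<Rightarrow> 'a"
  assumes N: "complex_norm UNIV N" and expanding: "\<And>t x. 0 \<le> t \<Longrightarrow> N x \<le> N (T t x)"
  shows "(\<forall>i<n. 0 \<le> ts i \<and> ts i \<le> t) \<Longrightarrow>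
    (\<forall>i<n. \<forall>j<n. i \<le> j \<longrightarrow> ts i \<le> ts j) \<Longrightarrow> 0 \<le> t \<Longrightarrow>
    T t x = y + (\<Sum>i<n. T (ts i) (xs i)) \<Longrightarrow> N x \<le> N y + (\<Sum>i<n. N (xs i))"
proof (induction n arbitrary: ts t xs x y)
  case 0
  then show ?case using expanding[of t x] by simp
next
  case (Suc n)
  interpret complex_norm UNIV N by fact
  define a where "a = ts 0"
  have a: "0 \<le> a" "a \<le> t" and ats: "\<And>i. i < n \<Longrightarrow> a \<le> ts (Suc i)"
    using Suc.prems(1,2) by (auto simp: a_def)
  define R where "R = (\<Sum>i<n. T (ts (Suc i) - a) (xs (Suc i)))"
  define z where "z = T (t - a) x - xs 0 - R"
  have "T a z = T t x - T a (xs 0) - (\<Sum>i<n. T (ts (Suc i)) (xs (Suc i)))"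
  proof -
    have "T a R = (\<Sum>i<n. T (ts (Suc i)) (xs (Suc i)))"
      unfolding R_def T_sum[OF a(1)]
    proof (rule sum.cong)
      fix i assume "i \<in> {..<n}"
      then show "T a (T (ts (Suc i) - a) (xs (Suc i))) = T (ts (Suc i)) (xs (Suc i))"
        using T_add[of a "ts (Suc i) - a"] a ats by simp
    qed simp
    moreover have "T a (T (t - a) x) = T t x" using T_add[of a "t - a" x] a by simp
    ultimately show ?thesis unfolding z_def using a by (simp add: T_diff)
  qed
  also have "\<dots> = y"
    unfolding Suc.prems(4) by (simp add: sum.lessThan_Suc_shift a_def del: sum.lessThan_Suc)
  finally have "N z \<le> N y" using expanding[OF a(1), of z] by simp
  have "N x \<le> N (z + xs 0) + (\<Sum>i<n. N (xs (Suc i)))"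
  proof (rule Suc.IH)
    show "T (t - a) x = z + xs 0 + (\<Sum>i<n. T (ts (Suc i) - a) (xs (Suc i)))"
      by (simp add: z_def R_def)
  qed (use Suc.prems(1,2) a ats in auto)
  also have "N (z + xs 0) \<le> N y + N (xs 0)"
    using q_triangle[of z "xs 0"] \<open>N z \<le> N y\<close> by simp
  finally show ?case by (simp add: sum.lessThan_Suc_shift del: sum.lessThan_Suc)
qed

lemma dissipative_imp_finite_sum_lower_bound:
  assumes "dissipative_renorming T"
  shows "finite_sum_lower_bound T"
proof -
  obtain N where N: "equivalent_norm N" and expanding: "\<And>t x. 0 \<le> t \<Longrightarrow> N x \<le> N (T t x)"
    using assms dissipative_renorming_iff_expanding by blast
  obtain c C where c: "c > 0" "C > 0" and b: "\<And>x. c * norm x \<le> N x" "\<And>x. N x \<le> C * norm x"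
    using N unfolding equivalent_norm_def by blast
  interpret complex_norm UNIV N using equivalent_norm_complex_norm[OF N] .
  show ?thesis
    unfolding finite_sum_lower_bound_def
  proof (intro exI[of _ "C / c"] allI impI)
    fix n x and xs :: "nat \<Rightarrow> 'a" and ts :: "nat \<Rightarrow> real" and t
    assume A: "1 \<le> n \<and> (\<forall>i\<in>{1..n}. 0 \<le> ts i \<and> ts i \<le> t) \<and>
      (\<forall>i\<in>{1..n}. \<forall>j\<in>{1..n}. i \<le> j \<longrightarrow> ts i \<le> ts j) \<and> T t x = (\<Sum>i = 1..n. T (ts i) (xs i))"
    have "N x \<le> N 0 + (\<Sum>i<n. N (xs (Suc i)))"
    proof (rule expanding_sum_bound[OF complex_norm_axioms expanding])
      have "1 \<in> {1..n}" using A by simp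
      then show "0 \<le> t" using A by force
      show "T t x = 0 + (\<Sum>i<n. T (ts (Suc i)) (xs (Suc i)))" using A by (simp add: sum.atLeast1_atMost_eq)
    qed (use A in auto)
    also have "\<dots> = (\<Sum>i = 1..n. N (xs i))" using eq_0[of 0] by (simp add: sum.atLeast1_atMost_eq)
    also have "\<dots> \<le> (\<Sum>i = 1..n. C * norm (xs i))" by (intro sum_mono b)
    finally have "c * norm x \<le> C * (\<Sum>i = 1..n. norm (xs i))"
      using b(1)[of x] by (simp add: sum_distrib_left)
    then show "norm x \<le> C / c * (\<Sum>i = 1..n. norm (xs i))" using c by (simp add: field_simps)
  qed
qed

end

section \<open>Group extensions give dissipative norms\<close>

text \<open>Boundedness of \<open>f\<close> is essential here: it makes the supremum that defines the operator norm a
supremum of a bounded set.\<close>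

lemma op_norm_on_bound:
  assumes V: "complex_norm_on V N" and f: "bounded_clinear_on V N V N f"
    and le: "op_norm_on V N f \<le> k" and x: "x \<in> V"
  shows "N (f x) \<le> k * N x"
proof (cases "x = 0")
  case True
  interpret complex_norm V N using V by unfold_locales
  have "f (0 *\<^sub>C x) = 0 *\<^sub>C f x" using f x unfolding bounded_clinear_on_def by blast
  then have "f 0 = 0" by simp
  then show ?thesis using True eq_0[OF x] by simp
next
  case False
  interpret complex_norm V N using V by unfold_locales
  have Nx: "N x > 0" using False eq_0[OF x] q_nonneg[OF x] by simp
  obtain K where K: "\<And>x. x \<in> V \<Longrightarrow> N (f x) \<le> K * N x"
    using f unfolding bounded_clinear_on_def by blast
  have "N (f y) / N y \<le> \<bar>K\<bar>" if "y \<in> V" for y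
  proof (cases "N y = 0")
    case False
    then have "N y > 0" using q_nonneg[OF that] by simp
    moreover have "N (f y) \<le> \<bar>K\<bar> * N y"
      using K[OF that] q_nonneg[OF that] by (meson abs_ge_self mult_right_mono order_trans)
    ultimately show ?thesis by (simp add: field_simps)
  qed simp
  then have "N (f x) / N x \<le> op_norm_on V N f"
    unfolding op_norm_on_def using x by (intro cSUP_upper bdd_aboveI[of _ "\<bar>K\<bar>"]) auto
  then have "N (f x) / N x \<le> k" using le by simp
  then show ?thesis using Nx by (simp add: field_simps)
qed

lemma op_norm_on_le:
  assumes V: "complex_norm_on V N" and k: "0 \<le> k" and le: "\<And>x. x \<in> V \<Longrightarrow> N (f x) \<le> k * N x"
  shows "op_norm_on V N f \<le> k"
proof -
  interpret complex_norm V N using V by unfold_locales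
  have "N (f x) / N x \<le> k" if "x \<in> V" for x
    using le[OF that] q_nonneg[OF that] k by (cases "N x = 0") (auto simp: field_simps)
  moreover have "V \<noteq> {}" using cvec.subspace_0[OF subspace_W] by blast
  ultimately show ?thesis unfolding op_norm_on_def by (intro cSUP_least) auto
qed

lemma renorming_from_embedding:
  fixes J :: "'a::complex_banach \<Rightarrow> 'y::complex_vector"
  assumes "complex_norm_on V N" "range J \<subseteq> V"
    and add: "\<And>x y. J (x + y) = J x + J y" and scale: "\<And>a x. J (a *\<^sub>C x) = a *\<^sub>C J x"
    and "c > 0" and low: "\<And>x. c * norm x \<le> N (J x)" and up: "\<And>x. N (J x) \<le> C * norm x"
  shows "equivalent_norm (\<lambda>x. N (J x))"
proof -
  interpret complex_norm V N using assms(1) by unfold_locales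
  have JV: "J x \<in> V" for x using assms(2) by blast
  have "J 0 = 0" using add[of 0 0] by simp
  then have "N (J x) = 0 \<longleftrightarrow> x = 0" for x
    using low[of x] \<open>c > 0\<close> eq_0[of "J 0"] JV[of 0] by (auto simp: mult_le_0_iff)
  moreover have "N (J x) \<le> max C 1 * norm x" for x
    using up[of x] mult_right_mono[of C "max C 1" "norm x"] by simp
  moreover have "max C 1 > 0" by simp
  ultimately show ?thesis
    unfolding equivalent_norm_def complex_norm_on_def
    using low \<open>c > 0\<close> JV q_nonneg q_triangle q_scaleC add scale
    by (intro conjI exI[of _ c] exI[of _ "max C 1"]) (auto simp: cvec.subspace_UNIV)
qed

context C0_semigroup
begin

lemma backward_contractive_group_imp_dissipative:
  assumes "embeds_in_backward_contractive_group TYPE('y::complex_vector) T"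
  shows "dissipative_renorming T"
proof -
  obtain V :: "'y set" and N J S where V: "complex_banach_on V N" and J: "isomorphic_embedding V N J"
    and S: "C0_group_on V N S" and contr: "\<And>t. t > 0 \<Longrightarrow> op_norm_on V N (S (- t)) \<le> 1"
    and ext: "\<And>x t. t > 0 \<Longrightarrow> S t (J x) = J (T t x)"
    using assms unfolding embeds_in_backward_contractive_group_def by auto
  have N: "complex_norm_on V N" using V unfolding complex_banach_on_def by blast
  interpret complex_norm V N using N by unfold_locales
  have JV: "J x \<in> V" for x using J unfolding isomorphic_embedding_def closed_csubspace_on_def by blast
  have inj: "inj J" using J unfolding isomorphic_embedding_def by blast
  obtain C where C: "\<And>x. N (J x) \<le> C * norm x" and add: "\<And>x y. J (x + y) = J x + J y"
    and scale: "\<And>a x. J (a *\<^sub>C x) = a *\<^sub>C J x"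
    using J unfolding isomorphic_embedding_def bounded_clinear_on_def by auto
  obtain K where K: "\<And>x. norm (inv J (J x)) \<le> K * N (J x)"
    using J unfolding isomorphic_embedding_def bounded_clinear_on_def by (meson rangeI)
  have low: "(1 / max K 1) * norm x \<le> N (J x)" for x
  proof -
    have "norm x \<le> K * N (J x)" using K[of x] inj by simp
    also have "\<dots> \<le> max K 1 * N (J x)" using q_nonneg[OF JV] by (intro mult_right_mono) auto
    finally show ?thesis by (simp add: field_simps)
  qed
  have eq: "equivalent_norm (\<lambda>x. N (J x))"
    by (rule renorming_from_embedding[OF N _ add scale _ low C]) (use JV in auto)
  have "N (J x) \<le> N (J (T t x))" if t: "0 \<le> t" for t x
  proof (cases "t = 0")
    case False
    with t have t: "t > 0" by simp
    have "J x = S (- t + t) (J x)" using S JV unfolding C0_group_on_def by simp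
    also have "\<dots> = S (- t) (S t (J x))" using S JV unfolding C0_group_on_def by blast
    also have "\<dots> = S (- t) (J (T t x))" using ext t by simp
    also have "N \<dots> \<le> 1 * N (J (T t x))"
      using S JV contr[OF t] by (intro op_norm_on_bound[OF N]) (auto simp: C0_group_on_def)
    finally show ?thesis by simp
  qed simp
  with eq show ?thesis unfolding dissipative_renorming_iff_expanding by blast
qed

text \<open>The norm \<open>P x\<close> is the supremum of \<open>N (S (-t) (J x))\<close> over \<open>t \<ge> 0\<close>. Replacing \<open>x\<close> by \<open>T s x\<close>
enlarges the set of times over which one takes the supremum from \<open>[0, \<infinity>)\<close> to \<open>[-s, \<infinity>)\<close>, so \<open>P\<close> is
expanding.\<close>

lemma backward_bounded_group_imp_dissipative:
  assumes "extends_to_backward_bounded_group TYPE('z::complex_vector) T"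
  shows "dissipative_renorming T"
proof -
  obtain V :: "'z set" and N J S \<kappa> where V: "complex_banach_on V N" and J: "isometric_embedding V N J"
    and S: "C0_group_extension V N J T S" and bd: "\<And>t. t \<ge> 0 \<Longrightarrow> op_norm_on V N (S (- t)) \<le> \<kappa>"
    using assms unfolding extends_to_backward_bounded_group_def by metis
  have N: "complex_norm_on V N" using V unfolding complex_banach_on_def by blast
  interpret complex_norm V N using N by unfold_locales
  have JV: "J x \<in> V" for x using J unfolding isometric_embedding_def closed_csubspace_on_def by blast
  have add: "\<And>x y. J (x + y) = J x + J y" and scale: "\<And>a x. J (a *\<^sub>C x) = a *\<^sub>C J x"
    and iso: "\<And>x. N (J x) = norm x"
    using J unfolding isometric_embedding_def bounded_clinear_on_def by auto
  have Sbl: "bounded_clinear_on V N V N (S t)" and S0: "y \<in> V \<Longrightarrow> S 0 y = y"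
    and S_add: "y \<in> V \<Longrightarrow> S (s + t) y = S s (S t y)" for s t y
    using S unfolding C0_group_extension_def C0_group_on_def by blast+
  have SV: "S t y \<in> V" if "y \<in> V" for t y using Sbl that unfolding bounded_clinear_on_def by blast
  have S_lin: "y \<in> V \<Longrightarrow> z \<in> V \<Longrightarrow> S t (y + z) = S t y + S t z"
    "y \<in> V \<Longrightarrow> S t (a *\<^sub>C y) = a *\<^sub>C S t y" for t y z a
    using Sbl unfolding bounded_clinear_on_def by blast+
  have ext: "S t (J x) = J (T t x)" if "0 \<le> t" for t x using S that unfolding C0_group_extension_def by blast
  have Nbd: "N (S (- t) y) \<le> \<kappa> * N y" if "0 \<le> t" "y \<in> V" for t y
    using op_norm_on_bound[OF N Sbl bd] that by blast
  define P where "P x = (SUP t\<in>{0..}. N (S (- t) (J x)))" for x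
  have bdd: "bdd_above ((\<lambda>t. N (S (- t) (J x))) ` {0..})" for x
    using Nbd[OF _ JV] by (intro bdd_aboveI[of _ "\<kappa> * N (J x)"]) auto
  have P_up: "N (S (- t) (J x)) \<le> P x" if "0 \<le> t" for t x
    unfolding P_def using bdd that by (intro cSUP_upper) auto
  have P_le: "P x \<le> b" if "\<And>t. 0 \<le> t \<Longrightarrow> N (S (- t) (J x)) \<le> b" for x b
    unfolding P_def using that by (intro cSUP_least) auto
  have low: "1 * norm x \<le> P x" for x using P_up[of 0 x] iso S0 JV by simp
  have up: "P x \<le> \<kappa> * norm x" for x using P_le[of x] Nbd[OF _ JV] iso by metis
  have "P x \<le> max \<kappa> 1 * norm x" for x
    using up[of x] mult_right_mono[of \<kappa> "max \<kappa> 1" "norm x"] by simp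
  moreover have "max \<kappa> 1 > 0" by simp
  moreover have "complex_norm_on UNIV P"
    unfolding complex_norm_on_def
  proof (intro conjI ballI allI cvec.subspace_UNIV)
    fix x y a
    show "0 \<le> P x" using low[of x] norm_ge_zero[of x] by linarith
    show "P x = 0 \<longleftrightarrow> x = 0" using low[of x] up[of x] by auto
    show "P (x + y) \<le> P x + P y"
    proof (rule P_le)
      fix t :: real assume t: "0 \<le> t"
      have "N (S (- t) (J (x + y))) \<le> N (S (- t) (J x)) + N (S (- t) (J y))"
        unfolding add using S_lin(1) JV SV q_triangle by metis
      then show "N (S (- t) (J (x + y))) \<le> P x + P y" using P_up[OF t] by (meson add_mono order_trans)
    qed
    have sc: "P (a *\<^sub>C x) \<le> cmod a * P x" for a x
    proof (rule P_le)
      fix t :: real assume t: "0 \<le> t"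
      have "N (S (- t) (J (a *\<^sub>C x))) = cmod a * N (S (- t) (J x))"
        unfolding scale using S_lin(2) JV SV q_scaleC by metis
      then show "N (S (- t) (J (a *\<^sub>C x))) \<le> cmod a * P x"
        using P_up[OF t] by (simp add: mult_left_mono)
    qed
    show "P (a *\<^sub>C x) = cmod a * P x"
    proof (cases "a = 0")
      case True
      then show ?thesis using low[of 0] up[of 0] by simp
    next
      case False
      have "P x = P (inverse a *\<^sub>C a *\<^sub>C x)" using False by (simp add: scaleC_scaleC scaleC_one)
      also have "\<dots> \<le> cmod (inverse a) * P (a *\<^sub>C x)" by (rule sc)
      finally have "cmod a * P x \<le> P (a *\<^sub>C x)" using False by (simp add: norm_inverse norm_divide field_simps)
      then show ?thesis using sc[of a x] by simp
    qed
  qed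
  ultimately have eq: "equivalent_norm P"
    unfolding equivalent_norm_def using low zero_less_one by blast
  have "P x \<le> P (T s x)" if s: "0 \<le> s" for s x
  proof (rule P_le)
    fix t :: real assume t: "0 \<le> t"
    have "S (- t) (J x) = S (- (t + s) + s) (J x)" by simp
    also have "\<dots> = S (- (t + s)) (J (T s x))" using S_add[OF JV] ext[OF s] by metis
    also have "N \<dots> \<le> P (T s x)" using s t by (intro P_up) simp
    finally show "N (S (- t) (J x)) \<le> P (T s x)" .
  qed
  with eq show ?thesis unfolding dissipative_renorming_iff_expanding by blast
qed

end

section \<open>Quotients of complete seminormed spaces\<close>

definition seq_complete_on :: "'v::complex_vector set \<Rightarrow> ('v \<Rightarrow> real) \<Rightarrow> bool" where
  "seq_complete_on W q \<longleftrightarrow>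
     (\<forall>f::nat \<Rightarrow> 'v. range f \<subseteq> W \<and> (\<forall>e>0. \<exists>M. \<forall>m\<ge>M. \<forall>n\<ge>M. q (f m - f n) < e) \<longrightarrow>
        (\<exists>x\<in>W. (\<lambda>n. q (f n - x)) \<longlonglongrightarrow> 0))"

lemma complex_banach_on_iff:
  "complex_banach_on V N \<longleftrightarrow> complex_norm_on V N \<and> seq_complete_on V N"
  unfolding complex_banach_on_def seq_complete_on_def ..

text \<open>Subtracting a linear projection onto \<open>Z\<close> leaves a projection onto a complement of \<open>Z\<close>; the former exists
because every basis of \<open>Z\<close> extends to a basis of the whole space.\<close>

lemma complex_subspace_projection:
  fixes Z :: "'v::complex_vector set"
  assumes Z: "cvec.subspace Z"
  obtains \<pi> where "Vector_Spaces.linear (*\<^sub>C) (*\<^sub>C) \<pi>" "\<And>z. z \<in> Z \<Longrightarrow> \<pi> z = 0" "\<And>x. x - \<pi> x \<in> Z"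
proof -
  interpret vector_space_pair "scaleC :: complex \<Rightarrow> 'v \<Rightarrow> 'v" "scaleC :: complex \<Rightarrow> 'v \<Rightarrow> 'v" ..
  have "Vector_Spaces.linear (*\<^sub>C) (*\<^sub>C) (id :: 'v \<Rightarrow> 'v)"
    by (rule cvec.linear_id)
  from linear_exists_left_inverse_on[OF this Z]
  obtain P where P: "range P \<subseteq> Z" "Vector_Spaces.linear (*\<^sub>C) (*\<^sub>C) P" "\<forall>v\<in>Z. P v = v"
    by auto
  show ?thesis
  proof
    show "Vector_Spaces.linear (*\<^sub>C) (*\<^sub>C) (\<lambda>x. x - P x)"
      by (intro linear_compose_sub cvec.linear_ident P)
  qed (use P in auto)
qed

text \<open>The quotient of \<open>W\<close> by the null space of \<open>q\<close>, realised inside \<open>W\<close>: \<open>\<pi>\<close> is the quotient map, its image is a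
linear complement of the null space, and since \<open>f\<close> and \<open>\<pi> f\<close> differ by a null vector, \<open>q\<close> itself is the
quotient norm on the image.\<close>

lemma seminormed_space_quotient:
  assumes "complex_seminorm W q" and complete: "seq_complete_on W q"
  obtains \<pi> where "Vector_Spaces.linear (*\<^sub>C) (*\<^sub>C) \<pi>"
    "\<And>f. f \<in> W \<Longrightarrow> \<pi> f \<in> W" "\<And>f. f \<in> W \<Longrightarrow> q (f - \<pi> f) = 0"
    "\<And>f. f \<in> W \<Longrightarrow> q f = 0 \<Longrightarrow> \<pi> f = 0"
    "complex_banach_on (\<pi> ` W) q"
proof -
  interpret complex_seminorm W q by fact
  define Z where "Z = {f\<in>W. q f = 0}"
  have Z: "cvec.subspace Z"
  proof (rule cvec.subspaceI)
    fix f g assume "f \<in> Z" "g \<in> Z"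
    then show "f + g \<in> Z"
      using q_triangle[of f g] q_nonneg[of "f + g"] W_closed by (auto simp: Z_def)
  qed (auto simp: Z_def W_closed q_0 q_scaleC)
  obtain \<pi> where lin: "Vector_Spaces.linear (*\<^sub>C) (*\<^sub>C) \<pi>"
    and \<pi>0: "\<And>z. z \<in> Z \<Longrightarrow> \<pi> z = 0" and \<pi>Z: "\<And>x. x - \<pi> x \<in> Z"
    using complex_subspace_projection[OF Z] by blast
  interpret \<pi>: Vector_Spaces.linear "(*\<^sub>C)" "(*\<^sub>C)" \<pi> by fact
  have \<pi>W: "\<pi> f \<in> W" if "f \<in> W" for f
    using cvec.subspace_diff[OF subspace_W that, of "f - \<pi> f"] \<pi>Z[of f] by (simp add: Z_def)
  have null: "q (f - \<pi> f) = 0" for f using \<pi>Z by (simp add: Z_def)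
  have idem: "\<pi> (\<pi> f) = \<pi> f" for f
    using \<pi>0[OF \<pi>Z[of f]] by (simp add: \<pi>.diff)
  have sub: "cvec.subspace (\<pi> ` W)" by (rule \<pi>.subspace_image[OF subspace_W])
  have norm: "complex_norm_on (\<pi> ` W) q"
    unfolding complex_norm_on_def
  proof (intro conjI ballI allI sub)
    fix v a u assume "v \<in> \<pi> ` W"
    then have v: "v \<in> W" "\<pi> v = v" using \<pi>W idem by auto
    show "0 \<le> q v" "q (a *\<^sub>C v) = cmod a * q v" using v q_nonneg q_scaleC by auto
    show "q v = 0 \<longleftrightarrow> v = 0" using v \<pi>0[of v] q_0 by (auto simp: Z_def)
    assume "u \<in> \<pi> ` W"
    then have "u \<in> W" using \<pi>W by auto
    then show "q (v + u) \<le> q v + q u" using v q_triangle by blast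
  qed
  have "seq_complete_on (\<pi> ` W) q"
    unfolding seq_complete_on_def
  proof (intro allI impI)
    fix f :: "nat \<Rightarrow> 'a"
    assume f: "range f \<subseteq> \<pi> ` W \<and> (\<forall>e>0. \<exists>M. \<forall>m\<ge>M. \<forall>n\<ge>M. q (f m - f n) < e)"
    have "\<pi> ` W \<subseteq> W" using \<pi>W by auto
    then have fW: "range f \<subseteq> W" by (rule order_trans[OF conjunct1[OF f]])
    obtain x where x: "x \<in> W" "(\<lambda>n. q (f n - x)) \<longlonglongrightarrow> 0"
      using complete[unfolded seq_complete_on_def, rule_format, OF conjI[OF fW conjunct2[OF f]]] ..
    have "q (f n - \<pi> x) = q (f n - x)" for n
    proof (rule q_eq_if_null_diff)
      have "f n \<in> W" using fW by blast
      then show "f n - \<pi> x \<in> W" "f n - x \<in> W" using x(1) \<pi>W W_closed(3) by blast+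
      show "q (f n - \<pi> x - (f n - x)) = 0" using null[of x] by simp
    qed
    then have "(\<lambda>n. q (f n - \<pi> x)) \<longlonglongrightarrow> 0" using x(2) by simp
    then show "\<exists>x\<in>\<pi> ` W. (\<lambda>n. q (f n - x)) \<longlonglongrightarrow> 0" using x(1) by blast
  qed
  then show ?thesis
    using that[OF lin \<pi>W null] \<pi>0 norm unfolding complex_banach_on_iff Z_def by blast
qed

definition quotient_seminorm :: "('v::complex_vector \<Rightarrow> real) \<Rightarrow> 'v set \<Rightarrow> 'v \<Rightarrow> real" where
  "quotient_seminorm q K f = (INF k\<in>K. q (f - k))"

locale seminorm_quotient = complex_seminorm W q
  for W :: "'v::complex_vector set" and q :: "'v \<Rightarrow> real" +
  fixes K :: "'v set"
  assumes subspace_K: "cvec.subspace K" and K_subset: "K \<subseteq> W"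
begin

abbreviation p :: "'v \<Rightarrow> real" where "p \<equiv> quotient_seminorm q K"

lemma p_le:
  assumes "f \<in> W" "k \<in> K"
  shows "p f \<le> q (f - k)"
proof -
  have "bdd_below ((\<lambda>k. q (f - k)) ` K)"
    using q_nonneg W_closed assms(1) K_subset by (intro bdd_belowI[of _ 0]) auto
  then show ?thesis unfolding quotient_seminorm_def using assms(2) by (rule cINF_lower)
qed

lemma p_greatest: "(\<And>k. k \<in> K \<Longrightarrow> b \<le> q (f - k)) \<Longrightarrow> b \<le> p f"
  unfolding quotient_seminorm_def using cvec.subspace_0[OF subspace_K] by (intro cINF_greatest) auto

lemma p_approx:
  assumes "p f < b"
  obtains k where "k \<in> K" "q (f - k) < b"
proof -
  have "\<not> (\<forall>k\<in>K. b \<le> q (f - k))" using p_greatest[of b f] assms by force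
  with that show ?thesis by force
qed

lemma p_le_q: "f \<in> W \<Longrightarrow> p f \<le> q f"
  using p_le[of f 0] cvec.subspace_0[OF subspace_K] by simp

lemma p_nonneg: "f \<in> W \<Longrightarrow> 0 \<le> p f"
  using q_nonneg W_closed K_subset by (intro p_greatest) auto

lemma p_null: "k \<in> K \<Longrightarrow> p k = 0"
  using p_le[of k k] p_nonneg[of k] q_0 K_subset by auto

lemma p_scaleC_le:
  assumes f: "f \<in> W" and a: "a \<noteq> 0"
  shows "p (a *\<^sub>C f) \<le> cmod a * p f"
proof -
  have "p (a *\<^sub>C f) / cmod a \<le> p f"
  proof (rule p_greatest)
    fix k assume k: "k \<in> K"
    have "p (a *\<^sub>C f) \<le> q (a *\<^sub>C f - a *\<^sub>C k)"
      using f k cvec.subspace_scale[OF subspace_K] W_closed by (intro p_le) auto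
    also have "\<dots> = cmod a * q (f - k)"
      using q_scaleC[of "f - k" a] f k K_subset W_closed by (auto simp: cvec.scale_right_diff_distrib)
    finally show "p (a *\<^sub>C f) / cmod a \<le> q (f - k)" using a by (simp add: field_simps)
  qed
  then show ?thesis using a by (simp add: field_simps)
qed

lemma complex_seminorm_p: "complex_seminorm W p"
proof
  show "cvec.subspace W" by (rule subspace_W)
  show "0 \<le> p f" if "f \<in> W" for f using p_nonneg that .
  show "p (f + g) \<le> p f + p g" if fg: "f \<in> W" "g \<in> W" for f g
  proof (rule field_le_epsilon)
    fix e :: real assume e: "e > 0"
    obtain k where k: "k \<in> K" "q (f - k) < p f + e / 2" using p_approx[of f "p f + e / 2"] e by auto
    obtain l where l: "l \<in> K" "q (g - l) < p g + e / 2" using p_approx[of g "p g + e / 2"] e by auto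
    have "p (f + g) \<le> q (f + g - (k + l))"
      using fg k l cvec.subspace_add[OF subspace_K] W_closed by (intro p_le) auto
    also have "f + g - (k + l) = (f - k) + (g - l)" by simp
    also have "q \<dots> \<le> q (f - k) + q (g - l)"
      using fg k l K_subset W_closed by (intro q_triangle) auto
    finally show "p (f + g) \<le> p f + p g + e" using k l by simp
  qed
  show "p (a *\<^sub>C f) = cmod a * p f" if f: "f \<in> W" for f a
  proof (cases "a = 0")
    case True
    then show ?thesis using p_null[of 0] cvec.subspace_0[OF subspace_K] by simp
  next
    case False
    have "p f = p (inverse a *\<^sub>C a *\<^sub>C f)" using False by (simp add: scaleC_scaleC scaleC_one)
    also have "\<dots> \<le> cmod (inverse a) * p (a *\<^sub>C f)"
      using f False W_closed by (intro p_scaleC_le) auto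
    finally have "cmod a * p f \<le> p (a *\<^sub>C f)"
      using False by (simp add: norm_inverse norm_divide field_simps)
    then show ?thesis using p_scaleC_le[OF f False] by simp
  qed
qed

lemma p_operator_bound:
  assumes U_diff: "\<And>f g. U (f - g) = U f - U g" and UW: "\<And>f. f \<in> W \<Longrightarrow> U f \<in> W"
    and UK: "\<And>k. k \<in> K \<Longrightarrow> U k \<in> K" and c: "c > 0" and bd: "\<And>f. f \<in> W \<Longrightarrow> q (U f) \<le> c * q f"
    and f: "f \<in> W"
  shows "p (U f) \<le> c * p f"
proof -
  have "p (U f) / c \<le> p f"
  proof (rule p_greatest)
    fix k assume k: "k \<in> K"
    have "p (U f) \<le> q (U f - U k)" using UW f UK k by (intro p_le) auto
    also have "\<dots> \<le> c * q (f - k)"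
      using bd[of "f - k"] f k K_subset W_closed by (auto simp: U_diff)
    finally show "p (U f) / c \<le> q (f - k)" using c by (simp add: field_simps)
  qed
  then show ?thesis using c by (simp add: field_simps)
qed

text \<open>A rapidly Cauchy subsequence can be corrected by elements of \<open>K\<close>, one after the other, to a sequence
\<open>h\<close> that is Cauchy for \<open>q\<close> itself. The \<open>q\<close>-limit of \<open>h\<close> is a \<open>p\<close>-limit of the subsequence, hence of
the whole sequence.\<close>

lemma seq_complete_on_p:
  assumes complete: "seq_complete_on W q"
  shows "seq_complete_on W p"
  unfolding seq_complete_on_def
proof (intro allI impI)
  interpret p: complex_seminorm W p by (rule complex_seminorm_p)
  fix f :: "nat \<Rightarrow> 'v"
  assume f: "range f \<subseteq> W \<and> (\<forall>e>0. \<exists>M. \<forall>m\<ge>M. \<forall>n\<ge>M. p (f m - f n) < e)"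
  have fW: "f n \<in> W" for n using conjunct1[OF f] by blast
  have "\<exists>M. \<forall>m\<ge>M. \<forall>n\<ge>M. p (f m - f n) < (1/2) ^ i" for i
    by (rule conjunct2[OF f, rule_format]) simp
  then obtain M where M: "\<And>i m n. m \<ge> M i \<Longrightarrow> n \<ge> M i \<Longrightarrow> p (f m - f n) < (1/2) ^ i"
    by metis
  define \<phi> where "\<phi> i = (\<Sum>j\<le>i. M j)" for i
  have \<phi>M: "M i \<le> \<phi> i" for i
    unfolding \<phi>_def using member_le_sum[of i "{..i}" M] by simp
  have \<phi>_mono: "\<phi> i \<le> \<phi> j" if "i \<le> j" for i j
    unfolding \<phi>_def using that by (intro sum_mono2) auto
  have "\<exists>k\<in>K. q ((f (\<phi> (Suc i)) - f (\<phi> i)) - k) < (1/2) ^ i" for i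
  proof -
    have "p (f (\<phi> (Suc i)) - f (\<phi> i)) < (1/2) ^ i"
      using \<phi>M[of i] \<phi>_mono[of i "Suc i"] by (intro M) auto
    then show ?thesis using p_approx by metis
  qed
  then obtain d where dK: "\<And>i. d i \<in> K" and d: "\<And>i. q ((f (\<phi> (Suc i)) - f (\<phi> i)) - d i) < (1/2) ^ i"
    by metis
  \<comment> \<open>\<open>h (n + 1) - h n\<close> is the corrected increment, of \<open>q\<close>-size below \<open>2\<close> to the power \<open>-n\<close>\<close>
  define h where "h n = f (\<phi> n) - (\<Sum>i<n. d i)" for n
  have DK: "(\<Sum>i<n. d i) \<in> K" for n using dK by (intro cvec.subspace_sum[OF subspace_K])
  then have hW: "h n \<in> W" for n unfolding h_def using fW K_subset by (blast intro: W_closed(3))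
  have step: "q (h (Suc n) - h n) < (1/2) ^ n" for n
  proof -
    have "h (Suc n) - h n = (f (\<phi> (Suc n)) - f (\<phi> n)) - d n"
      unfolding h_def sum.lessThan_Suc by (simp only: algebra_simps)
    then show ?thesis using d by simp
  qed
  have tail: "q (h (n + m) - h n) \<le> 2 * (1/2) ^ n - 2 * (1/2) ^ (n + m)" for n m
  proof (induction m)
    case 0
    show ?case by (simp add: q_0)
  next
    case (Suc m)
    have "q (h (n + Suc m) - h n) \<le> q (h (Suc (n + m)) - h (n + m)) + q (h (n + m) - h n)"
      using q_triangle_via[OF hW hW hW] by simp
    also have "\<dots> \<le> (1/2) ^ (n + m) + (2 * (1/2) ^ n - 2 * (1/2) ^ (n + m))"
      using step[of "n + m"] Suc by (intro add_mono) auto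
    also have "\<dots> = 2 * (1/2) ^ n - 2 * (1/2) ^ (n + Suc m)" by simp
    finally show ?case .
  qed
  have tail': "q (h m - h n) \<le> 2 * (1/2) ^ n" if "n \<le> m" for n m
  proof -
    have "q (h m - h n) \<le> 2 * (1/2) ^ n - 2 * (1/2) ^ m" using tail[of n "m - n"] that by simp
    also have "\<dots> \<le> 2 * (1/2) ^ n" by simp
    finally show ?thesis .
  qed
  have "\<exists>L. \<forall>m\<ge>L. \<forall>n\<ge>L. q (h m - h n) < e" if e: "e > 0" for e
  proof -
    obtain L where L: "(1/2 :: real) ^ L < e / 4" using e real_arch_pow_inv[of "e / 4" "1/2"] by auto
    have "q (h m - h n) < e" if "m \<ge> L" "n \<ge> L" for m n
    proof -
      have "q (h m - h n) \<le> q (h m - h L) + q (h L - h n)" by (rule q_triangle_via[OF hW hW hW])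
      also have "\<dots> = q (h m - h L) + q (h n - h L)" using q_commute[OF hW hW] by simp
      also have "\<dots> \<le> 2 * (1/2) ^ L + 2 * (1/2) ^ L" using that by (intro add_mono tail')
      finally show ?thesis using L by simp
    qed
    then show ?thesis by blast
  qed
  then obtain x where x: "x \<in> W" and lim: "(\<lambda>n. q (h n - x)) \<longlonglongrightarrow> 0"
    using complete hW unfolding seq_complete_on_def by blast
  have "(\<lambda>n. p (f n - x)) \<longlonglongrightarrow> 0"
  proof (rule LIMSEQ_I)
    fix e :: real assume e: "e > 0"
    obtain i where i: "(1/2 :: real) ^ i < e / 2" using e real_arch_pow_inv[of "e / 2" "1/2"] by auto
    obtain n0 where n0: "\<And>n. n \<ge> n0 \<Longrightarrow> norm (q (h n - x) - 0) < e / 2"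
      using LIMSEQ_D[OF lim, of "e / 2"] e by auto
    define n where "n = max i n0"
    have pq: "p (f (\<phi> n) - x) < e / 2"
    proof -
      have "p (f (\<phi> n) - x) \<le> q (f (\<phi> n) - x - (\<Sum>i<n. d i))"
        using fW x DK W_closed by (intro p_le) auto
      also have "f (\<phi> n) - x - (\<Sum>i<n. d i) = h n - x" by (simp add: h_def algebra_simps)
      also have "q (h n - x) < e / 2" using n0[of n] by (simp add: n_def)
      finally show ?thesis .
    qed
    have "norm (p (f m - x) - 0) < e" if m: "m \<ge> \<phi> i" for m
    proof -
      have "M i \<le> \<phi> n" using \<phi>M[of i] \<phi>_mono[of i n] by (simp add: n_def)
      then have "p (f m - f (\<phi> n)) < (1/2) ^ i" using m \<phi>M[of i] by (intro M) auto
      moreover have "p (f m - x) \<le> p (f m - f (\<phi> n)) + p (f (\<phi> n) - x)"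
        using fW x by (intro p.q_triangle_via) auto
      moreover have "0 \<le> p (f m - x)" using fW x W_closed by (intro p_nonneg) auto
      ultimately show ?thesis using pq i by simp
    qed
    then show "\<exists>no. \<forall>n\<ge>no. norm (p (f n - x) - 0) < e" by blast
  qed
  with x show "\<exists>x\<in>W. (\<lambda>n. p (f n - x)) \<longlonglongrightarrow> 0" by blast
qed

end

text \<open>A group of operators on \<open>W\<close> that is bounded for the seminorm preserves its null space, so it descends to the
quotient, where it becomes \<open>\<pi> \<circ> U t\<close>. The group law survives because \<open>\<pi> \<circ> U t\<close> does not
see whether \<open>\<pi>\<close> has been applied before.\<close>

lemma quotient_C0_group:
  assumes sn: "complex_seminorm W q" and lin: "Vector_Spaces.linear (*\<^sub>C) (*\<^sub>C) \<pi>"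
    and \<pi>W: "\<And>f. f \<in> W \<Longrightarrow> \<pi> f \<in> W" and null: "\<And>f. f \<in> W \<Longrightarrow> q (f - \<pi> f) = 0"
    and \<pi>0: "\<And>f. f \<in> W \<Longrightarrow> q f = 0 \<Longrightarrow> \<pi> f = 0"
    and U_lin: "\<And>t. Vector_Spaces.linear (*\<^sub>C) (*\<^sub>C) (U t)"
    and UW: "\<And>t f. f \<in> W \<Longrightarrow> U t f \<in> W" and U_bd: "\<And>t f. f \<in> W \<Longrightarrow> q (U t f) \<le> c t * q f"
    and U_0: "\<And>f. U 0 f = f" and U_add: "\<And>s t f. U (s + t) f = U s (U t f)"
    and U_cont: "\<And>f. f \<in> W \<Longrightarrow> ((\<lambda>t. q (U t f - f)) \<longlongrightarrow> 0) (at 0)"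
  shows "C0_group_on (\<pi> ` W) q (\<lambda>t f. \<pi> (U t f))"
    and "f \<in> W \<Longrightarrow> \<pi> (U t (\<pi> f)) = \<pi> (U t f)"
    and "f \<in> W \<Longrightarrow> q (\<pi> f) = q f"
proof -
  interpret complex_seminorm W q by fact
  interpret \<pi>: Vector_Spaces.linear "(*\<^sub>C)" "(*\<^sub>C)" \<pi> by fact
  interpret U: Vector_Spaces.linear "(*\<^sub>C)" "(*\<^sub>C)" "U t" for t by (rule U_lin)
  have cong: "\<pi> f = \<pi> g" if "f \<in> W" "g \<in> W" "q (f - g) = 0" for f g
    using \<pi>0[of "f - g"] that W_closed by (simp add: \<pi>.diff)
  have idem: "\<pi> (\<pi> f) = \<pi> f" if "f \<in> W" for f
    using cong[of f "\<pi> f"] that \<pi>W null by simp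
  show absorb: "\<pi> (U t (\<pi> f)) = \<pi> (U t f)" if "f \<in> W" for f t
  proof (rule cong)
    have "q (U t (\<pi> f - f)) \<le> c t * q (\<pi> f - f)" using that \<pi>W W_closed by (intro U_bd) auto
    also have "\<dots> = 0" using null[OF that] q_commute[of f "\<pi> f"] that \<pi>W by simp
    finally show "q (U t (\<pi> f) - U t f) = 0"
      using q_nonneg[of "U t (\<pi> f - f)"] UW that \<pi>W W_closed by (simp add: U.diff)
  qed (use that UW \<pi>W in auto)
  show q_\<pi>: "q (\<pi> f) = q f" if "f \<in> W" for f
    using q_eq_if_null_diff[of f "\<pi> f"] null that \<pi>W by simp
  have in_W: "f \<in> W" if "f \<in> \<pi> ` W" for f using that \<pi>W by auto
  show "C0_group_on (\<pi> ` W) q (\<lambda>t f. \<pi> (U t f))"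
    unfolding C0_group_on_def bounded_clinear_on_def
  proof (intro conjI allI ballI)
    show "(\<lambda>f. \<pi> (U t f)) ` \<pi> ` W \<subseteq> \<pi> ` W" for t using UW \<pi>W by auto
    show "\<pi> (U t (f + g)) = \<pi> (U t f) + \<pi> (U t g)" for t f g by (simp add: U.add \<pi>.add)
    show "\<pi> (U t (a *\<^sub>C f)) = a *\<^sub>C \<pi> (U t f)" for t a f by (simp add: U.scale \<pi>.scale)
    show "\<exists>K. \<forall>f\<in>\<pi> ` W. q (\<pi> (U t f)) \<le> K * q f" for t
      using U_bd in_W UW q_\<pi> by (intro exI[of _ "c t"]) auto
    fix f assume f: "f \<in> \<pi> ` W"
    then show "\<pi> (U 0 f) = f" using idem by (auto simp: U_0)
    show "\<pi> (U (s + t) f) = \<pi> (U s (\<pi> (U t f)))" for s t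
      using absorb[of "U t f" s] in_W[OF f] UW by (simp add: U_add)
    have "q (\<pi> (U t f) - f) = q (U t f - f)" for t
    proof -
      have "\<pi> (U t f) - f = \<pi> (U t f - f)" using f idem by (auto simp: \<pi>.diff)
      then show ?thesis using q_\<pi>[of "U t f - f"] in_W[OF f] UW W_closed by simp
    qed
    then show "((\<lambda>t. q (\<pi> (U t f) - f)) \<longlongrightarrow> 0) (at 0)" using U_cont in_W[OF f] by simp
  qed
qed

section \<open>Weighted summable functions\<close>

definition l1 :: "('i \<Rightarrow> real) \<Rightarrow> ('i \<Rightarrow> 'a::real_normed_vector) set" where
  "l1 w = {f. (\<lambda>i. w i * norm (f i)) summable_on UNIV}"

definition l1_norm :: "('i \<Rightarrow> real) \<Rightarrow> ('i \<Rightarrow> 'a::real_normed_vector) \<Rightarrow> real" where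
  "l1_norm w f = (\<Sum>\<^sub>\<infinity>i. w i * norm (f i))"

definition point_mass :: "'i \<Rightarrow> 'a \<Rightarrow> 'i \<Rightarrow> 'a::zero" where
  "point_mass i x = (\<lambda>j. if j = i then x else 0)"

lemma point_mass_linear:
  "point_mass i (x + y) = point_mass i x + point_mass i (y :: 'a::complex_vector)"
  "point_mass i (x - y) = point_mass i x - point_mass i y"
  "point_mass i (a *\<^sub>C x) = a *\<^sub>C point_mass i x"
  by (auto simp: point_mass_def fun_eq_iff scaleC_fun_def)

locale weight =
  fixes w :: "'i \<Rightarrow> real"
  assumes w_pos: "w i > 0"
begin

lemma finite_sum_le_l1_norm:
  assumes "f \<in> l1 w" "finite F"
  shows "(\<Sum>i\<in>F. w i * norm (f i)) \<le> l1_norm w f"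
  unfolding l1_norm_def using assms w_pos
  by (intro finite_sum_le_infsum) (auto simp: l1_def less_imp_le)

text \<open>Membership in the space and bounds for its norm can be checked on finite sums; the triangle inequality,
completeness and the effect of translations all follow from this.\<close>

lemma l1_normI:
  assumes "\<And>F. finite F \<Longrightarrow> (\<Sum>i\<in>F. w i * norm (f i)) \<le> b"
  shows "f \<in> l1 w" "l1_norm w f \<le> b"
proof -
  have "(\<lambda>i. w i * norm (f i)) summable_on UNIV"
    using assms w_pos by (intro nonneg_bdd_above_summable_on bdd_aboveI[of _ b]) (auto simp: less_imp_le)
  then show "f \<in> l1 w" by (simp add: l1_def)
  show "l1_norm w f \<le> b"
    unfolding l1_norm_def using assms
    by (intro infsum_le_finite_sums \<open>(\<lambda>i. w i * norm (f i)) summable_on UNIV\<close>) auto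
qed

lemma l1_norm_nonneg: "0 \<le> l1_norm w f"
  unfolding l1_norm_def using w_pos by (intro infsum_nonneg) (simp add: less_imp_le)

lemma l1_norm_triangle:
  assumes "f \<in> l1 w" "g \<in> l1 w"
  shows "f + g \<in> l1 w" "l1_norm w (f + g) \<le> l1_norm w f + l1_norm w g"
proof -
  have "(\<Sum>i\<in>F. w i * norm ((f + g) i)) \<le> l1_norm w f + l1_norm w g" if "finite F" for F
  proof -
    have "(\<Sum>i\<in>F. w i * norm ((f + g) i)) \<le> (\<Sum>i\<in>F. w i * norm (f i) + w i * norm (g i))"
      using w_pos by (intro sum_mono)
        (auto simp: distrib_left[symmetric] less_imp_le intro!: mult_left_mono norm_triangle_ineq)
    also have "\<dots> \<le> l1_norm w f + l1_norm w g"
      unfolding sum.distrib using assms that by (intro add_mono finite_sum_le_l1_norm)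
    finally show ?thesis .
  qed
  then show "f + g \<in> l1 w" "l1_norm w (f + g) \<le> l1_norm w f + l1_norm w g"
    using l1_normI by blast+
qed

lemma complex_seminorm_l1: "complex_seminorm (l1 w :: ('i \<Rightarrow> 'a::complex_banach) set) (l1_norm w)"
proof
  have sc: "(\<lambda>i. w i * norm ((a *\<^sub>C f) i)) = (\<lambda>i. cmod a * (w i * norm (f i)))"
    for a and f :: "'i \<Rightarrow> 'a"
    by (auto simp: scaleC_fun_def norm_scaleC fun_eq_iff)
  show "cvec.subspace (l1 w :: ('i \<Rightarrow> 'a) set)"
  proof (rule cvec.subspaceI)
    show "0 \<in> (l1 w :: ('i \<Rightarrow> 'a) set)" by (simp add: l1_def)
    show "a *\<^sub>C f \<in> l1 w" if "f \<in> l1 w" for a and f :: "'i \<Rightarrow> 'a"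
      using that by (simp add: l1_def sc summable_on_cmult_right)
  qed (rule l1_norm_triangle)
  show "l1_norm w (a *\<^sub>C f) = cmod a * l1_norm w f" for a and f :: "'i \<Rightarrow> 'a"
    unfolding l1_norm_def sc by (rule infsum_cmult_right')
qed (use l1_norm_nonneg l1_norm_triangle in auto)

text \<open>The pointwise limit is the limit in norm, since finite partial sums of the norm pass to the limit.\<close>

lemma seq_complete_on_l1: "seq_complete_on (l1 w :: ('i \<Rightarrow> 'a::complex_banach) set) (l1_norm w)"
  unfolding seq_complete_on_def
proof (intro allI impI)
  interpret complex_seminorm "l1 w :: ('i \<Rightarrow> 'a) set" "l1_norm w" by (rule complex_seminorm_l1)
  fix f :: "nat \<Rightarrow> 'i \<Rightarrow> 'a"
  assume f: "range f \<subseteq> l1 w \<and> (\<forall>e>0. \<exists>M. \<forall>m\<ge>M. \<forall>n\<ge>M. l1_norm w (f m - f n) < e)"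
  have fW: "f n \<in> l1 w" for n using conjunct1[OF f] by blast
  have dW: "f m - f n \<in> l1 w" for m n using fW W_closed(3) by blast
  have cauchy: "\<exists>M. \<forall>m\<ge>M. \<forall>n\<ge>M. l1_norm w (f m - f n) < e" if "e > 0" for e
    using conjunct2[OF f] that by blast
  have "Cauchy (\<lambda>n. f n i)" for i
  proof (rule CauchyI)
    fix e :: real assume e: "e > 0"
    obtain M where M: "\<forall>m\<ge>M. \<forall>n\<ge>M. l1_norm w (f m - f n) < w i * e"
      using cauchy[of "w i * e"] e w_pos by auto
    have "norm (f m i - f n i) < e" if "m \<ge> M" "n \<ge> M" for m n
    proof -
      have "w i * norm (f m i - f n i) \<le> l1_norm w (f m - f n)"
        using finite_sum_le_l1_norm[OF dW, of "{i}"] by simp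
      also have "\<dots> < w i * e" using M that by blast
      finally show ?thesis using w_pos by simp
    qed
    then show "\<exists>M. \<forall>m\<ge>M. \<forall>n\<ge>M. norm (f m i - f n i) < e" by blast
  qed
  then have "\<exists>l. (\<lambda>n. f n i) \<longlonglongrightarrow> l" for i using Cauchy_convergent convergent_def by blast
  then obtain g where g: "\<And>i. (\<lambda>n. f n i) \<longlonglongrightarrow> g i" by metis
  have close: "f n - g \<in> l1 w \<and> l1_norm w (f n - g) \<le> e"
    if M: "\<forall>m\<ge>M. \<forall>n\<ge>M. l1_norm w (f m - f n) < e" and n: "n \<ge> M" for e M n
  proof -
    have "(\<Sum>i\<in>F. w i * norm ((f n - g) i)) \<le> e" if F: "finite F" for F
    proof (rule tendsto_upperbound)
      show "(\<lambda>m. \<Sum>i\<in>F. w i * norm ((f n - f m) i)) \<longlonglongrightarrow> (\<Sum>i\<in>F. w i * norm ((f n - g) i))"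
        unfolding fun_diff_def by (intro tendsto_intros g)
      show "\<forall>\<^sub>F m in sequentially. (\<Sum>i\<in>F. w i * norm ((f n - f m) i)) \<le> e"
        using eventually_ge_at_top[of M]
      proof eventually_elim
        case (elim m)
        then show ?case
          using finite_sum_le_l1_norm[OF dW F, of n m] M n by (meson less_imp_le order_trans)
      qed
    qed simp
    then show ?thesis using l1_normI by blast
  qed
  have gW: "g \<in> l1 w"
  proof -
    obtain M where "\<forall>m\<ge>M. \<forall>n\<ge>M. l1_norm w (f m - f n) < 1" using cauchy[of 1] by auto
    from close[OF this order_refl] have "f M - (f M - g) \<in> l1 w" using fW W_closed(3) by blast
    then show ?thesis by simp
  qed
  have "(\<lambda>n. l1_norm w (f n - g)) \<longlonglongrightarrow> 0"
  proof (rule LIMSEQ_I)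
    fix e :: real assume e: "e > 0"
    obtain M where M: "\<forall>m\<ge>M. \<forall>n\<ge>M. l1_norm w (f m - f n) < e / 2" using cauchy[of "e / 2"] e by auto
    have "norm (l1_norm w (f n - g) - 0) < e" if "n \<ge> M" for n
      using close[OF M that] l1_norm_nonneg[of "f n - g"] e by simp
    then show "\<exists>no. \<forall>n\<ge>no. norm (l1_norm w (f n - g) - 0) < e" by blast
  qed
  with gW show "\<exists>x\<in>l1 w. (\<lambda>n. l1_norm w (f n - x)) \<longlonglongrightarrow> 0" by blast
qed

lemma finite_support_l1:
  assumes F: "finite F" and f: "\<And>i. i \<notin> F \<Longrightarrow> f i = 0"
  shows "f \<in> l1 w" "l1_norm w f = (\<Sum>i\<in>F. w i * norm (f i))"
proof -
  have "((\<lambda>i. w i * norm (f i)) has_sum (\<Sum>i\<in>F. w i * norm (f i))) UNIV"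
    by (rule has_sum_finite_neutralI[OF F]) (use f in auto)
  then show "f \<in> l1 w" "l1_norm w f = (\<Sum>i\<in>F. w i * norm (f i))"
    by (auto simp: l1_def l1_norm_def has_sum_imp_summable infsumI)
qed

lemma point_mass_l1: "point_mass i x \<in> l1 w" "l1_norm w (point_mass i x) = w i * norm x"
  using finite_support_l1[of "{i}" "point_mass i x"] by (auto simp: point_mass_def)

lemma finite_support_dense_l1:
  fixes f :: "'i \<Rightarrow> 'a::complex_banach"
  assumes f: "f \<in> l1 w" and e: "e > 0"
  obtains F where "finite F" "l1_norm w (f - (\<lambda>i. if i \<in> F then f i else 0)) \<le> e"
proof -
  have "(\<lambda>i. w i * norm (f i)) summable_on UNIV" using f by (simp add: l1_def)
  from infsum_finite_approximation[OF this e]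
  obtain F where F: "finite F" "dist (\<Sum>i\<in>F. w i * norm (f i)) (l1_norm w f) \<le> e"
    unfolding l1_norm_def by auto
  have "l1_norm w (f - (\<lambda>i. if i \<in> F then f i else 0)) \<le> e"
  proof (rule l1_normI)
    fix G :: "'i set" assume G: "finite G"
    have "(\<Sum>i\<in>G. w i * norm ((f - (\<lambda>i. if i \<in> F then f i else 0)) i))
        = (\<Sum>i\<in>G - F. w i * norm (f i))"
      by (rule sum.mono_neutral_cong_right) (use G in auto)
    also have "\<dots> = (\<Sum>i\<in>G \<union> F. w i * norm (f i)) - (\<Sum>i\<in>F. w i * norm (f i))"
      using sum.union_disjoint[of "G - F" F "\<lambda>i. w i * norm (f i)"] G F(1)
      by (simp add: Un_Diff_cancel2 Diff_disjoint[of F G, unfolded Int_commute[of F]])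
    also have "\<dots> \<le> e"
      using finite_sum_le_l1_norm[OF f, of "G \<union> F"] G F by (auto simp: dist_real_def)
    finally show "(\<Sum>i\<in>G. w i * norm ((f - (\<lambda>i. if i \<in> F then f i else 0)) i)) \<le> e" .
  qed
  with F that show ?thesis by blast
qed

end

section \<open>Translations\<close>

definition translate :: "real \<Rightarrow> (real \<Rightarrow> 'a) \<Rightarrow> real \<Rightarrow> 'a" where
  "translate t f = (\<lambda>r. f (r - t))"

lemma translate_linear: "Vector_Spaces.linear (*\<^sub>C) (*\<^sub>C) (translate t :: (real \<Rightarrow> 'a::complex_vector) \<Rightarrow> _)"
  unfolding Vector_Spaces.linear_iff
  by (intro conjI cvec.vector_space_axioms) (auto simp: translate_def scaleC_fun_def fun_eq_iff)

lemma translate_add: "translate (s + t) f = translate s (translate t f)"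
  by (auto simp: translate_def fun_eq_iff algebra_simps)

lemma translate_0: "translate 0 f = f"
  by (simp add: translate_def)

lemma translate_point_mass: "translate t (point_mass r x) = point_mass (r + t) x"
  by (auto simp: translate_def point_mass_def fun_eq_iff)


lemma translate_l1:
  fixes f :: "real \<Rightarrow> 'a::real_normed_vector"
  assumes "weight w" and shift: "\<And>r. w (r + t) \<le> c * w r" and f: "f \<in> l1 w" and c: "c \<ge> 0"
  shows "translate t f \<in> l1 w" "l1_norm w (translate t f) \<le> c * l1_norm w f"
proof -
  interpret weight w by fact
  have "(\<Sum>r\<in>F. w r * norm (translate t f r)) \<le> c * l1_norm w f" if F: "finite F" for F
  proof -
    have "(\<Sum>r\<in>F. w r * norm (translate t f r)) = (\<Sum>r\<in>(\<lambda>r. r - t) ` F. w (r + t) * norm (f r))"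
      by (subst sum.reindex) (auto simp: translate_def inj_on_def)
    also have "\<dots> \<le> (\<Sum>r\<in>(\<lambda>r. r - t) ` F. c * (w r * norm (f r)))"
      using mult_right_mono[OF shift] by (intro sum_mono) (simp add: mult.assoc)
    also have "\<dots> \<le> c * l1_norm w f"
      unfolding sum_distrib_left[symmetric] using F f c
      by (intro mult_left_mono finite_sum_le_l1_norm) auto
    finally show ?thesis .
  qed
  then show "translate t f \<in> l1 w" "l1_norm w (translate t f) \<le> c * l1_norm w f"
    using l1_normI by blast+
qed

context C0_semigroup
begin

section \<open>The group generated by formal sums modulo relations\<close>

text \<open>With \<open>f\<close> read as the formal sum of the \<open>S r (f r)\<close> for a group \<open>S\<close> that extends \<open>T\<close>, the relations are the
finite sums that become \<open>0\<close> when \<open>S t\<close> with large \<open>t\<close> moves them to nonnegative times, where \<open>T\<close>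
can evaluate them. Because all large \<open>t\<close> are admitted, any two relations can be tested at the same times.\<close>

definition relations :: "(real \<Rightarrow> 'a) set" where
  "relations = {k. \<exists>F. finite F \<and> (\<forall>r. r \<notin> F \<longrightarrow> k r = 0) \<and>
     (\<forall>\<^sub>F t in at_top. (\<Sum>r\<in>F. T (t + r) (k r)) = 0)}"

lemma relationsE:
  assumes "k \<in> relations"
  obtains F where "finite F" "\<forall>r. r \<notin> F \<longrightarrow> k r = 0"
    "\<forall>\<^sub>F t in at_top. (\<Sum>r\<in>F. T (t + r) (k r)) = 0"
proof -
  obtain F where "finite F \<and> (\<forall>r. r \<notin> F \<longrightarrow> k r = 0) \<and>
     (\<forall>\<^sub>F t in at_top. (\<Sum>r\<in>F. T (t + r) (k r)) = 0)"
    using assms unfolding relations_def by blast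
  then show ?thesis using that by blast
qed

lemma relationsI:
  assumes "finite F" "\<forall>r. r \<notin> F \<longrightarrow> k r = 0"
    "\<forall>\<^sub>F t in at_top. (\<Sum>r\<in>F. T (t + r) (k r)) = 0"
  shows "k \<in> relations"
  using assms unfolding relations_def by blast

lemma eventually_ge_on_finite:
  fixes F :: "real set"
  assumes "finite F"
  shows "\<forall>\<^sub>F t::real in at_top. \<forall>r\<in>F. 0 \<le> t + r"
  using assms
proof (intro eventually_ball_finite ballI)
  fix r assume "r \<in> F"
  show "\<forall>\<^sub>F t::real in at_top. 0 \<le> t + r"
    using eventually_ge_at_top[of "- r"] by eventually_elim simp
qed auto

lemma relations_sum_superset:
  assumes G: "finite G" and FG: "F \<subseteq> G" and k: "\<forall>r. r \<notin> F \<longrightarrow> k r = 0"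
  shows "\<forall>\<^sub>F t in at_top. (\<Sum>r\<in>G. T (t + r) (k r)) = (\<Sum>r\<in>F. T (t + r) (k r))"
  using eventually_ge_on_finite[OF G]
proof eventually_elim
  case (elim t)
  show ?case
    by (rule sum.mono_neutral_right) (use G FG k elim T_zero in auto)
qed

lemma relations_eventually:
  assumes k: "k \<in> relations" and G: "finite G" and kG: "\<forall>r. r \<notin> G \<longrightarrow> k r = 0"
  shows "\<forall>\<^sub>F t in at_top. (\<Sum>r\<in>G. T (t + r) (k r)) = 0"
proof -
  obtain F where F: "finite F" "\<forall>r. r \<notin> F \<longrightarrow> k r = 0"
    "\<forall>\<^sub>F t in at_top. (\<Sum>r\<in>F. T (t + r) (k r)) = 0"
    using k by (rule relationsE)
  have FG: "finite (F \<union> G)" using F G by simp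
  show ?thesis
    using F(3) relations_sum_superset[where k = k, OF FG Un_upper1 F(2)]
      relations_sum_superset[where k = k, OF FG Un_upper2 kG]
    by eventually_elim simp
qed

lemma subspace_relations: "cvec.subspace relations"
proof (rule cvec.subspaceI)
  show "0 \<in> relations" by (rule relationsI[of "{}"]) auto
  show "k + l \<in> relations" if k: "k \<in> relations" and l: "l \<in> relations" for k l
  proof -
    obtain F where F: "finite F" "\<forall>r. r \<notin> F \<longrightarrow> k r = 0"
      "\<forall>\<^sub>F t in at_top. (\<Sum>r\<in>F. T (t + r) (k r)) = 0"
      using k by (rule relationsE)
    obtain G where G: "finite G" "\<forall>r. r \<notin> G \<longrightarrow> l r = 0"
      "\<forall>\<^sub>F t in at_top. (\<Sum>r\<in>G. T (t + r) (l r)) = 0"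
      using l by (rule relationsE)
    have FG: "finite (F \<union> G)" "\<forall>r. r \<notin> F \<union> G \<longrightarrow> k r = 0" "\<forall>r. r \<notin> F \<union> G \<longrightarrow> l r = 0"
      using F G by auto
    have "\<forall>\<^sub>F t in at_top. (\<Sum>r\<in>F \<union> G. T (t + r) ((k + l) r)) = 0"
      using eventually_ge_on_finite[OF FG(1)]
        relations_eventually[OF k FG(1,2)] relations_eventually[OF l FG(1,3)]
    proof eventually_elim
      case (elim t)
      have "(\<Sum>r\<in>F \<union> G. T (t + r) ((k + l) r)) =
        (\<Sum>r\<in>F \<union> G. T (t + r) (k r)) + (\<Sum>r\<in>F \<union> G. T (t + r) (l r))"
        unfolding sum.distrib[symmetric] by (rule sum.cong) (use elim(1) T_plus in auto)
      then show ?case using elim by simp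
    qed
    then show ?thesis using FG by (intro relationsI[of "F \<union> G"]) auto
  qed
  show "a *\<^sub>C k \<in> relations" if k: "k \<in> relations" for a k
  proof -
    obtain F where F: "finite F" "\<forall>r. r \<notin> F \<longrightarrow> k r = 0"
      "\<forall>\<^sub>F t in at_top. (\<Sum>r\<in>F. T (t + r) (k r)) = 0"
      using k by (rule relationsE)
    have "\<forall>\<^sub>F t in at_top. (\<Sum>r\<in>F. T (t + r) ((a *\<^sub>C k) r)) = 0"
      using F(3) eventually_ge_on_finite[OF F(1)]
    proof eventually_elim
      case (elim t)
      have "(\<Sum>r\<in>F. T (t + r) ((a *\<^sub>C k) r)) = a *\<^sub>C (\<Sum>r\<in>F. T (t + r) (k r))"
        unfolding cvec.scale_sum_right scaleC_fun_def
        by (rule sum.cong) (use elim T_scaleC in auto)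
      then show ?case using elim by simp
    qed
    then show ?thesis using F by (intro relationsI[of F]) (auto simp: scaleC_fun_def)
  qed
qed

lemma translate_relations:
  assumes "k \<in> relations"
  shows "translate s k \<in> relations"
proof -
  obtain F where F: "finite F" "\<forall>r. r \<notin> F \<longrightarrow> k r = 0"
    "\<forall>\<^sub>F t in at_top. (\<Sum>r\<in>F. T (t + r) (k r)) = 0"
    using assms by (rule relationsE)
  have "filterlim (\<lambda>t. s + t) at_top (at_top :: real filter)"
    by (rule filterlim_tendsto_add_at_top[OF tendsto_const filterlim_ident])
  from eventually_compose_filterlim[OF F(3) this]
  have "\<forall>\<^sub>F t in at_top. (\<Sum>r\<in>(\<lambda>r. r + s) ` F. T (t + r) (translate s k r)) = 0"
    by (subst sum.reindex) (auto simp: inj_on_def translate_def add.commute add.left_commute)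
  moreover have "translate s k r = 0" if "r \<notin> (\<lambda>r. r + s) ` F" for r
    using F(2)[rule_format, of "r - s"] that by (force simp: translate_def)
  ultimately show ?thesis
    using F(1) by (intro relationsI[of "(\<lambda>r. r + s) ` F"]) auto
qed

text \<open>The relation \<open>S t x = T t x\<close>, which makes the group an extension of the semigroup.\<close>

lemma orbit_relation:
  assumes t: "0 \<le> t"
  shows "point_mass t x - point_mass 0 (T t x) \<in> relations"
proof (cases "t = 0")
  case True
  then show ?thesis using cvec.subspace_0[OF subspace_relations] by simp
next
  case False
  have "\<forall>\<^sub>F s in at_top. (\<Sum>r\<in>{0, t}. T (s + r) ((point_mass t x - point_mass 0 (T t x)) r)) = 0"
    using eventually_ge_at_top[of 0]
  proof eventually_elim
    case (elim s)
    have "T s (0 - T t x) = T s 0 - T s (T t x)" using elim by (rule T_diff)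
    then have "T s (- T t x) = - T (s + t) x" using elim t T_add[of s t x] T_zero[OF elim] by simp
    then show ?case using False by (simp add: point_mass_def)
  qed
  then show ?thesis
    by (intro relationsI[of "{0, t}"]) (auto simp: point_mass_def)
qed

lemma relations_subset_l1: "weight w \<Longrightarrow> relations \<subseteq> l1 w"
  by (auto elim!: relationsE intro: weight.finite_support_l1(1))

text \<open>The hypothesis \<open>low\<close> bounds the distance of \<open>x\<close>, placed at time \<open>0\<close>, from the relations, which is
the quotient norm of \<open>J x\<close>. The quotient construction gives the rest, except the strong continuity:
at the point masses at time \<open>0\<close> it is the continuity of \<open>T\<close>, translations carry it to all point masses,
and their finite sums are dense.\<close>

lemma group_from_weight:
  assumes w: "weight w" and D: "D \<ge> 0" and \<omega>: "\<omega> \<ge> 0"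
    and shift: "\<And>r t. w (r + t) \<le> D * exp (\<omega> * max t 0) * w r"
    and b: "b > 0"
    and low: "\<And>x k. k \<in> relations \<Longrightarrow> b * norm x \<le> l1_norm w (point_mass 0 x - k)"
  obtains V :: "(real \<Rightarrow> 'a) set" and N J S where
    "complex_banach_on V N" "C0_group_on V N S" "range J \<subseteq> V"
    "\<And>x y. J (x + y) = J x + J y" "\<And>a x. J (a *\<^sub>C x) = a *\<^sub>C J x"
    "\<And>x. b * norm x \<le> N (J x)" "\<And>x. N (J x) \<le> w 0 * norm x"
    "\<And>t x. 0 \<le> t \<Longrightarrow> S t (J x) = J (T t x)"
    "\<And>t y. y \<in> V \<Longrightarrow> N (S t y) \<le> D * exp (\<omega> * max t 0) * N y"
proof -
  interpret weight w by (rule w)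
  define W where "W = (l1 w :: (real \<Rightarrow> 'a) set)"
  interpret seminorm_quotient W "l1_norm w" relations
    unfolding W_def seminorm_quotient_def seminorm_quotient_axioms_def
    by (intro conjI complex_seminorm_l1 subspace_relations relations_subset_l1[OF w])
  interpret p: complex_seminorm W p by (rule complex_seminorm_p)
  define c where "c t = D * exp (\<omega> * max t 0)" for t
  have "D > 0" using shift[of 0 0] w_pos[of 0] D by (cases "D = 0") auto
  then have c_pos: "c t > 0" for t by (simp add: c_def)
  have pmW: "point_mass r x \<in> W" for r x by (simp add: W_def point_mass_l1)
  have UW: "translate t f \<in> W" if "f \<in> W" for t f
    using translate_l1(1)[OF w shift] that D unfolding W_def by simp
  interpret U: Vector_Spaces.linear "(*\<^sub>C)" "(*\<^sub>C)" "translate t :: (real \<Rightarrow> 'a) \<Rightarrow> _" for t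
    by (rule translate_linear)
  have "l1_norm w (translate t f) \<le> c t * l1_norm w f" if "f \<in> W" for t f
    unfolding c_def by (rule translate_l1(2)[OF w shift]) (use that D in \<open>auto simp: W_def\<close>)
  then have U_bd: "p (translate t f) \<le> c t * p f" if "f \<in> W" for t f
    using that by (intro p_operator_bound[where U = "translate t"] U.diff UW translate_relations c_pos)
  have same: "p (translate t (point_mass 0 x) - f) = p (point_mass 0 (T t x) - f)"
    if t: "0 \<le> t" and f: "f \<in> W" for t x f
    using p.q_eq_if_null_diff[of "point_mass t x - f" "point_mass 0 (T t x) - f"]
      p_null[OF orbit_relation[OF t, of x]] W_closed(3)[OF pmW f]
    by (simp add: translate_point_mass)
  have pm_le: "p (point_mass r x) \<le> w r * norm x" for r x
    using p_le_q[OF pmW] point_mass_l1(2) by metis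

  have cont_0: "((\<lambda>h. p (translate h (point_mass 0 x) - point_mass 0 x)) \<longlongrightarrow> 0) (at 0)" for x
  proof (rule Lim_null_comparison)
    \<comment> \<open>\<open>D + 1\<close> covers both signs: the factor is \<open>1\<close> for \<open>h \<ge> 0\<close> and \<open>D\<close> for \<open>h < 0\<close>\<close>
    define d where "d h = (D + 1) * (w 0 * norm (T \<bar>h\<bar> x - x))" for h
    have pos: "p (translate h (point_mass 0 x) - point_mass 0 x) \<le> w 0 * norm (T h x - x)"
      if "0 \<le> h" for h
      using same[OF that pmW, of x 0 x] pm_le[of 0 "T h x - x"] by (simp add: point_mass_linear(2))
    have "p (translate h (point_mass 0 x) - point_mass 0 x) \<le> d h" for h
    proof (cases "0 \<le> h")
      case True
      have "1 * (w 0 * norm (T h x - x)) \<le> (D + 1) * (w 0 * norm (T h x - x))"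
        using D w_pos[of 0] by (intro mult_right_mono) auto
      then show ?thesis using pos[OF True] True by (simp add: d_def)
    next
      case False
      \<comment> \<open>for \<open>h < 0\<close> the difference is, up to sign, the \<open>h\<close>-translate of the one for \<open>-h\<close>\<close>
      define \<delta> where "\<delta> = translate (- h) (point_mass 0 x) - point_mass 0 x"
      have \<delta>W: "\<delta> \<in> W" unfolding \<delta>_def using UW pmW W_closed(3) by blast
      have "translate h (point_mass 0 x) - point_mass 0 x = - translate h \<delta>"
        unfolding \<delta>_def U.diff translate_add[symmetric] by (simp add: translate_0)
      then have "p (translate h (point_mass 0 x) - point_mass 0 x) = p (translate h \<delta>)"
        using p.q_minus UW \<delta>W by simp
      also have "\<dots> \<le> c h * p \<delta>" by (rule U_bd[OF \<delta>W])
      also have "\<dots> = D * p \<delta>" using False by (simp add: c_def)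
      also have "\<dots> \<le> D * (w 0 * norm (T (- h) x - x))"
        unfolding \<delta>_def using False D by (intro mult_left_mono pos) auto
      also have "\<dots> \<le> d h"
        unfolding d_def using False w_pos[of 0] by (simp add: mult_right_mono)
      finally show ?thesis .
    qed
    moreover have "0 \<le> p (translate h (point_mass 0 x) - point_mass 0 x)" for h
      using UW pmW W_closed(3) by (intro p_nonneg) blast
    ultimately show "\<forall>\<^sub>F h in at 0. norm (p (translate h (point_mass 0 x) - point_mass 0 x)) \<le> d h"
      by (intro always_eventually) simp
    have "filterlim (\<lambda>h::real. \<bar>h\<bar>) (at_right 0) (at 0)"
      by (rule tendsto_imp_filterlim_at_right)
        (auto intro!: tendsto_eq_intros simp: eventually_at_filter)
    from filterlim_compose[OF T_tendsto_at_0 this]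
    have "((\<lambda>h. T \<bar>h\<bar> x) \<longlongrightarrow> x) (at 0)" .
    then have "((\<lambda>h. norm (T \<bar>h\<bar> x - x)) \<longlongrightarrow> 0) (at 0)"
      by (intro tendsto_norm_zero LIM_zero)
    then show "(d \<longlongrightarrow> 0) (at 0)"
      unfolding d_def by (intro tendsto_mult_right_zero)
  qed

  define C where "C = {f\<in>W. ((\<lambda>h. p (translate h f - f)) \<longlongrightarrow> 0) (at 0)}"
  have C_pm: "point_mass r x \<in> C" for r x
  proof -
    have eq: "point_mass r x = translate r (point_mass 0 x)" by (simp add: translate_point_mass)
    have "((\<lambda>h. p (translate h (point_mass r x) - point_mass r x)) \<longlongrightarrow> 0) (at 0)"
    proof (rule Lim_null_comparison)
      have "p (translate h (point_mass r x) - point_mass r x)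
          \<le> c r * p (translate h (point_mass 0 x) - point_mass 0 x)" for h
      proof -
        have "translate h (point_mass r x) - point_mass r x
          = translate r (translate h (point_mass 0 x) - point_mass 0 x)"
          unfolding eq U.diff by (simp add: translate_add[symmetric] add.commute)
        then show ?thesis using U_bd UW pmW W_closed(3) by simp
      qed
      moreover have "0 \<le> p (translate h (point_mass r x) - point_mass r x)" for h
        using UW pmW W_closed(3) by (intro p_nonneg) blast
      ultimately show "\<forall>\<^sub>F h in at 0. norm (p (translate h (point_mass r x) - point_mass r x))
          \<le> c r * p (translate h (point_mass 0 x) - point_mass 0 x)"
        by (intro always_eventually) simp
      show "((\<lambda>h. c r * p (translate h (point_mass 0 x) - point_mass 0 x)) \<longlongrightarrow> 0) (at 0)"
        by (intro tendsto_mult_right_zero cont_0)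
    qed
    then show ?thesis by (simp add: C_def pmW)
  qed
  have C_add: "f + g \<in> C" if "f \<in> C" "g \<in> C" for f g
  proof -
    have fg: "f \<in> W" "g \<in> W" using that by (auto simp: C_def)
    have "((\<lambda>h. p (translate h (f + g) - (f + g))) \<longlongrightarrow> 0) (at 0)"
    proof (rule Lim_null_comparison)
      have "p (translate h (f + g) - (f + g)) \<le> p (translate h f - f) + p (translate h g - g)" for h
      proof -
        have "translate h (f + g) - (f + g) = (translate h f - f) + (translate h g - g)"
          by (simp add: U.add)
        then show ?thesis using p.q_triangle UW fg W_closed(3) by metis
      qed
      moreover have "0 \<le> p (translate h (f + g) - (f + g))" for h
        using UW fg W_closed(2,3) by (intro p_nonneg) blast
      ultimately show "\<forall>\<^sub>F h in at 0. norm (p (translate h (f + g) - (f + g)))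
          \<le> p (translate h f - f) + p (translate h g - g)"
        by (intro always_eventually) simp
      show "((\<lambda>h. p (translate h f - f) + p (translate h g - g)) \<longlongrightarrow> 0) (at 0)"
        using that by (auto simp: C_def intro: tendsto_add_zero)
    qed
    then show ?thesis using fg W_closed(2) by (simp add: C_def)
  qed
  have C_finite: "(\<lambda>r. if r \<in> F then f r else 0) \<in> C" if "finite F" for F f
    using that
  proof (induction F)
    case empty
    have "(\<lambda>r. if r \<in> {} then f r else 0) = point_mass 0 0" by (auto simp: point_mass_def)
    then show ?case using C_pm by metis
  next
    case (insert s F)
    have "(\<lambda>r. if r \<in> insert s F then f r else 0) = (\<lambda>r. if r \<in> F then f r else 0) + point_mass s (f s)"
      using insert.hyps by (auto simp: point_mass_def fun_eq_iff)
    then show ?case using C_add[OF insert.IH C_pm] by simp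
  qed
  have U_cont: "((\<lambda>h. p (translate h f - f)) \<longlongrightarrow> 0) (at 0)" if f: "f \<in> W" for f
  proof (rule tendstoI)
    fix e :: real assume e: "e > 0"
    \<comment> \<open>bounds \<open>c h + 1\<close> for \<open>h \<le> 1\<close>, the factor with which the tail \<open>f - g\<close> enters\<close>
    define E where "E = D * exp \<omega> + 1"
    have E: "E > 0" using D by (simp add: E_def add_nonneg_pos)
    obtain F where F: "finite F"
      "l1_norm w (f - (\<lambda>i. if i \<in> F then f i else 0)) \<le> e / (2 * E)"
      using finite_support_dense_l1[of f "e / (2 * E)"] f e E by (auto simp: W_def)
    define g where "g = (\<lambda>i. if i \<in> F then f i else 0)"
    have gC: "g \<in> C" unfolding g_def by (rule C_finite[OF F(1)])
    then have g: "g \<in> W" by (simp add: C_def)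
    have fg: "f - g \<in> W" using f g W_closed(3) by blast
    have pfg: "p (f - g) \<le> e / (2 * E)" using p_le_q[OF fg] F(2) by (simp add: g_def)
    have "\<forall>\<^sub>F h in at 0. p (translate h g - g) < e / 2"
      using gC e by (intro order_tendstoD(2)[of _ 0]) (auto simp: C_def)
    moreover have "\<forall>\<^sub>F h::real in at 0. h < 1"
      by (rule order_tendstoD[OF tendsto_ident_at]) simp
    ultimately show "\<forall>\<^sub>F h in at 0. dist (p (translate h f - f)) 0 < e"
    proof eventually_elim
      case (elim h)
      have "translate h f - f = (translate h (f - g) - (f - g)) + (translate h g - g)"
        by (simp add: U.diff)
      then have "p (translate h f - f) \<le> p (translate h (f - g) - (f - g)) + p (translate h g - g)"
        using p.q_triangle UW fg g W_closed(3) by metis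
      also have "p (translate h (f - g) - (f - g)) \<le> p (translate h (f - g)) + p (f - g)"
        using p.q_diff UW fg by blast
      also have "p (translate h (f - g)) \<le> (D * exp \<omega>) * p (f - g)"
      proof -
        have "c h \<le> D * exp \<omega>"
          unfolding c_def using D \<omega> elim mult_left_mono[of "max h 0" 1 \<omega>] by (intro mult_left_mono) auto
        then show ?thesis using U_bd[OF fg, of h] p_nonneg[OF fg] by (meson mult_right_mono order_trans)
      qed
      also have "(D * exp \<omega>) * p (f - g) + p (f - g) = E * p (f - g)" by (simp add: E_def algebra_simps)
      also have "\<dots> \<le> E * (e / (2 * E))" using pfg E by (intro mult_left_mono) auto
      also have "\<dots> = e / 2" using E by simp
      finally have "p (translate h f - f) < e" using elim(1) by linarith
      moreover have "0 \<le> p (translate h f - f)" using UW f W_closed(3) by (intro p_nonneg) blast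
      ultimately show ?case by simp
    qed
  qed

  have complete: "seq_complete_on W p"
    by (rule seq_complete_on_p) (simp add: W_def seq_complete_on_l1)
  obtain \<pi> where \<pi>: "Vector_Spaces.linear (*\<^sub>C) (*\<^sub>C) \<pi>"
    "\<And>f. f \<in> W \<Longrightarrow> \<pi> f \<in> W" "\<And>f. f \<in> W \<Longrightarrow> p (f - \<pi> f) = 0"
    "\<And>f. f \<in> W \<Longrightarrow> p f = 0 \<Longrightarrow> \<pi> f = 0" and banach: "complex_banach_on (\<pi> ` W) p"
    using seminormed_space_quotient[OF complex_seminorm_p complete] by metis
  interpret \<pi>: Vector_Spaces.linear "(*\<^sub>C)" "(*\<^sub>C)" \<pi> by (rule \<pi>(1))
  note hyps = complex_seminorm_p \<pi> translate_linear UW U_bd translate_0 translate_add U_cont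
  have group: "C0_group_on (\<pi> ` W) p (\<lambda>t f. \<pi> (translate t f))"
    by (rule quotient_C0_group(1)[where U = translate and c = c]) (fact hyps | rule hyps, assumption)+
  have absorb: "\<pi> (translate t (\<pi> f)) = \<pi> (translate t f)" if "f \<in> W" for t f
    by (rule quotient_C0_group(2)[where U = translate and c = c and W = W and q = p])
      (fact hyps that | rule hyps, assumption)+
  have p_\<pi>: "p (\<pi> f) = p f" if "f \<in> W" for f
    by (rule quotient_C0_group(3)[where U = translate and c = c and W = W and q = p])
      (fact hyps that | rule hyps, assumption)+
  define J where "J x = \<pi> (point_mass 0 x)" for x
  show ?thesis
  proof
    show "complex_banach_on (\<pi> ` W) p" by (rule banach)
    show "C0_group_on (\<pi> ` W) p (\<lambda>t f. \<pi> (translate t f))" by (rule group)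
    show "range J \<subseteq> \<pi> ` W" by (auto simp: J_def pmW)
    show "J (x + y) = J x + J y" "J (a *\<^sub>C x) = a *\<^sub>C J x" for x y a
      by (simp_all add: J_def point_mass_linear \<pi>.add \<pi>.scale)
    have pJ: "p (J x) = p (point_mass 0 x)" for x using p_\<pi>[OF pmW] by (simp add: J_def)
    show "b * norm x \<le> p (J x)" for x unfolding pJ by (rule p_greatest[OF low])
    show "p (J x) \<le> w 0 * norm x" for x unfolding pJ by (rule pm_le)
    show "\<pi> (translate t (J x)) = J (T t x)" if t: "0 \<le> t" for t x
    proof -
      have "\<pi> (point_mass t x - point_mass 0 (T t x)) = 0"
        using \<pi>(4) p_null[OF orbit_relation[OF t]] pmW W_closed(3) by blast
      then show ?thesis using absorb[OF pmW, of t 0 x] by (simp add: J_def translate_point_mass \<pi>.diff)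
    qed
    show "p (\<pi> (translate t y)) \<le> D * exp (\<omega> * max t 0) * p y" if "y \<in> \<pi> ` W" for t y
    proof -
      have "y \<in> W" using that \<pi>(2) by auto
      then show ?thesis using p_\<pi>[OF UW] U_bd by (simp add: c_def)
    qed
  qed
qed

end

section \<open>From the finite sum condition to group extensions\<close>

text \<open>If the images \<open>J (x n)\<close> converge, then \<open>x\<close> is Cauchy, and \<open>J\<close> maps its limit to the limit of the images.\<close>

lemma range_closed_if_bounded_below:
  fixes J :: "'a::complex_banach \<Rightarrow> 'y::complex_vector"
  assumes V: "complex_norm_on V N" and JV: "range J \<subseteq> V"
    and add: "\<And>x y. J (x + y) = J x + J y" and scale: "\<And>a x. J (a *\<^sub>C x) = a *\<^sub>C J x"
    and b: "b > 0" "\<And>x. b * norm x \<le> N (J x)" and C: "\<And>x. N (J x) \<le> C * norm x"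
  shows "closed_csubspace_on V N (range J)"
  unfolding closed_csubspace_on_def
proof (intro conjI allI impI JV)
  interpret complex_norm V N using V by unfold_locales
  have J_diff: "J (x - y) = J x - J y" for x y
    using add[of "x - y" y] by (simp add: algebra_simps)
  have J_V: "J x \<in> V" for x using JV by blast
  show "cvec.subspace (range J)"
  proof (rule cvec.subspaceI)
    have "J 0 = 0" using add[of 0 0] by simp
    then show "0 \<in> range J" by (intro range_eqI[of _ _ 0]) simp
    show "f + g \<in> range J" if fg: "f \<in> range J" "g \<in> range J" for f g
    proof -
      obtain u v where "f = J u" "g = J v" using fg by (elim rangeE)
      then have "f + g = J (u + v)" by (simp add: add)
      then show ?thesis by (rule range_eqI)
    qed
    show "a *\<^sub>C f \<in> range J" if f: "f \<in> range J" for a f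
    proof -
      obtain u where "f = J u" using f by (elim rangeE)
      then have "a *\<^sub>C f = J (a *\<^sub>C u)" by (simp add: scale)
      then show ?thesis by (rule range_eqI)
    qed
  qed
  fix f :: "nat \<Rightarrow> 'y" and y
  assume A: "range f \<subseteq> range J \<and> y \<in> V \<and> (\<lambda>n. N (f n - y)) \<longlonglongrightarrow> 0"
  then have yV: "y \<in> V" and lim: "(\<lambda>n. N (f n - y)) \<longlonglongrightarrow> 0" by simp_all
  have "f n \<in> range J" for n using conjunct1[OF A] by (rule subsetD) (rule rangeI)
  then have x: "f n = J (inv J (f n))" for n by (simp add: f_inv_into_f)
  define x where "x n = inv J (f n)" for n
  have x: "f n = J (x n)" for n using x[of n] by (simp add: x_def)
  have V_diff: "u - v \<in> V" if "u \<in> V" "v \<in> V" for u v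
    using cvec.subspace_diff[OF subspace_W] that .
  have dist: "b * norm (x m - x n) \<le> N (f m - y) + N (f n - y)" for m n
  proof -
    have "b * norm (x m - x n) \<le> N (f m - f n)" using b(2)[of "x m - x n"] by (simp add: x J_diff)
    also have "f m - f n = (f m - y) - (f n - y)" by simp
    also have "N \<dots> \<le> N (f m - y) + N (f n - y)"
      using J_V yV V_diff by (intro q_diff) (auto simp: x)
    finally show ?thesis .
  qed
  have "Cauchy x"
  proof (rule CauchyI)
    fix e :: real assume e: "e > 0"
    obtain L where L: "\<And>n. n \<ge> L \<Longrightarrow> norm (N (f n - y) - 0) < b * e / 2"
      using LIMSEQ_D[OF lim, of "b * e / 2"] b e by auto
    have "norm (x m - x n) < e" if "m \<ge> L" "n \<ge> L" for m n
    proof -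
      have "b * norm (x m - x n) < b * e" using dist[of m n] L[OF that(1)] L[OF that(2)] by auto
      then show ?thesis using b by simp
    qed
    then show "\<exists>M. \<forall>m\<ge>M. \<forall>n\<ge>M. norm (x m - x n) < e" by blast
  qed
  then obtain l where l: "x \<longlonglongrightarrow> l" using Cauchy_convergent convergent_def by blast
  have "(\<lambda>n. C * norm (x n - l) + N (f n - y)) \<longlonglongrightarrow> C * 0 + 0"
    by (intro tendsto_intros tendsto_norm_zero LIM_zero l lim)
  moreover have "N (J l - y) \<le> C * norm (x n - l) + N (f n - y)" for n
  proof -
    have "J l - y = (f n - y) - J (x n - l)" by (simp add: x J_diff)
    also have "N \<dots> \<le> N (f n - y) + N (J (x n - l))"
      using J_V yV V_diff by (intro q_diff) (auto simp: x)
    finally show ?thesis using C[of "x n - l"] by simp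
  qed
  ultimately have "N (J l - y) \<le> 0" by (intro tendsto_lowerbound[where F = sequentially]) auto
  then have "J l - y = 0" using q_nonneg[of "J l - y"] eq_0[of "J l - y"] J_V yV V_diff by auto
  then show "y \<in> range J" by (intro range_eqI[of _ _ l]) simp
qed

context C0_semigroup
begin

text \<open>A form without enumeration: the times are values of a monotone function on a finite set of reals, whose
increasing enumeration gives the sorted lists of the condition. The empty sum is the case \<open>n = 1\<close>
with vector \<open>0\<close>.\<close>

lemma finite_sum_lower_bound_finite_set:
  assumes "finite_sum_lower_bound T"
  shows "\<exists>\<kappa>\<ge>1. \<forall>(F :: real set) \<tau> g t x. finite F \<longrightarrow> mono \<tau> \<longrightarrow>
       (\<forall>r\<in>F. 0 \<le> \<tau> r \<and> \<tau> r \<le> t) \<longrightarrow> 0 \<le> t \<longrightarrow>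
       T t x = (\<Sum>r\<in>F. T (\<tau> r) (g r)) \<longrightarrow> norm x \<le> \<kappa> * (\<Sum>r\<in>F. norm (g r))"
proof -
  obtain \<kappa> where \<kappa>0: "\<forall>(n::nat) x xs ts t. 1 \<le> n \<and> (\<forall>i\<in>{1..n}. 0 \<le> ts i \<and> ts i \<le> t) \<and>
        (\<forall>i\<in>{1..n}. \<forall>j\<in>{1..n}. i \<le> j \<longrightarrow> ts i \<le> ts j) \<and>
        T t x = (\<Sum>i=1..n. T (ts i) (xs i)) \<longrightarrow> norm x \<le> \<kappa> * (\<Sum>i=1..n. norm (xs i))"
    using assms unfolding finite_sum_lower_bound_def ..
  have \<kappa>: "norm x \<le> \<kappa> * (\<Sum>i=1..n. norm (xs i))"
    if "1 \<le> n" "\<forall>i\<in>{1..n}. 0 \<le> ts i \<and> ts i \<le> t"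
      "\<forall>i\<in>{1..n}. \<forall>j\<in>{1..n}. i \<le> j \<longrightarrow> ts i \<le> ts j"
      "T t x = (\<Sum>i=1..n. T (ts i) (xs i))" for n :: nat and x xs ts t
    by (rule \<kappa>0[THEN spec[of _ n], THEN spec[of _ x], THEN spec[of _ xs], THEN spec[of _ ts],
          THEN spec[of _ t], THEN mp]) (intro conjI that)
  have "norm x \<le> max 1 \<kappa> * (\<Sum>r\<in>F. norm (g r))"
    if F: "finite F" and \<tau>: "mono \<tau>" "\<forall>r\<in>F. 0 \<le> \<tau> r \<and> \<tau> r \<le> t" and t: "0 \<le> t"
      and eq: "T t x = (\<Sum>r\<in>F. T (\<tau> r) (g r))" for F :: "real set" and \<tau> g t x
  proof (cases "F = {}")
    case True
    have "norm x \<le> \<kappa> * (\<Sum>i=1..(1::nat). norm ((\<lambda>_. 0 :: 'a) i))"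
      by (rule \<kappa>[where ts = "\<lambda>_. 0" and t = t]) (use t eq True in auto)
    then show ?thesis using True by simp
  next
    case False
    define s where "s i = sorted_list_of_set F ! (i - 1)" for i
    define n where "n = card F"
    have len: "length (sorted_list_of_set F) = n" by (simp add: n_def)
    have bij: "bij_betw s {1..n} F"
    proof -
      have "bij_betw ((!) (sorted_list_of_set F)) {..<n} F"
        using bij_betw_nth[of "sorted_list_of_set F" "{..<n}" F] F len by simp
      moreover have "bij_betw (\<lambda>i. i - 1) {1..n} {..<n}"
        by (rule bij_betw_byWitness[of _ Suc]) auto
      ultimately have "bij_betw ((!) (sorted_list_of_set F) \<circ> (\<lambda>i. i - 1)) {1..n} F"
        by (rule bij_betw_trans[rotated])
      moreover have "(!) (sorted_list_of_set F) \<circ> (\<lambda>i. i - 1) = s" by (simp add: s_def fun_eq_iff)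
      ultimately show ?thesis by simp
    qed
    have sF: "s i \<in> F" if "i \<in> {1..n}" for i using bij that by (auto simp: bij_betw_def)
    have s_mono: "s i \<le> s j" if "i \<in> {1..n}" "j \<in> {1..n}" "i \<le> j" for i j
      unfolding s_def using that len by (intro sorted_nth_mono) auto
    have "norm x \<le> \<kappa> * (\<Sum>i=1..n. norm (g (s i)))"
    proof (rule \<kappa>)
      show "1 \<le> n" using False F by (simp add: n_def Suc_le_eq card_gt_0_iff)
      show "\<forall>i\<in>{1..n}. 0 \<le> \<tau> (s i) \<and> \<tau> (s i) \<le> t" using sF \<tau>(2) by blast
      show "\<forall>i\<in>{1..n}. \<forall>j\<in>{1..n}. i \<le> j \<longrightarrow> \<tau> (s i) \<le> \<tau> (s j)"
        using s_mono \<tau>(1) by (auto simp: mono_def)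
      show "T t x = (\<Sum>i=1..n. T (\<tau> (s i)) (g (s i)))"
        using eq sum.reindex_bij_betw[OF bij, of "\<lambda>r. T (\<tau> r) (g r)"] by simp
    qed
    also have "(\<Sum>i=1..n. norm (g (s i))) = (\<Sum>r\<in>F. norm (g r))"
      using sum.reindex_bij_betw[OF bij, of "\<lambda>r. norm (g r)"] .
    also have "\<kappa> * (\<Sum>r\<in>F. norm (g r)) \<le> max 1 \<kappa> * (\<Sum>r\<in>F. norm (g r))"
      by (intro mult_right_mono sum_nonneg) auto
    finally show ?thesis .
  qed
  then show ?thesis by (intro exI[of _ "max 1 \<kappa>"] conjI allI impI) simp_all
qed

text \<open>The condition only concerns times up to \<open>t\<close>, but in \<open>T (t + r) (f r)\<close> the number \<open>r\<close> may be positive. Then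
\<open>T r\<close> is moved to the vector, which costs the factor \<open>M exp (\<omega> r)\<close>.\<close>

lemma lower_bound_modulo_relations:
  assumes flb: "finite_sum_lower_bound T"
    and M: "M \<ge> 1" and \<omega>: "\<omega> \<ge> 0"
    and growth: "\<And>t x. 0 \<le> t \<Longrightarrow> norm (T t x) \<le> M * exp (\<omega> * t) * norm x"
  shows "\<exists>\<kappa>\<ge>1. \<forall>G f x. finite G \<longrightarrow> (\<forall>\<^sub>F t in at_top. (\<Sum>r\<in>G. T (t + r) (f r)) = T t x) \<longrightarrow>
       norm x \<le> \<kappa> * (\<Sum>r\<in>G. M * exp (\<omega> * max r 0) * norm (f r))"
proof -
  obtain \<kappa> where \<kappa>: "\<kappa> \<ge> 1" and bound: "\<forall>(F :: real set) \<tau> g t x. finite F \<longrightarrow> mono \<tau> \<longrightarrow>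
      (\<forall>r\<in>F. 0 \<le> \<tau> r \<and> \<tau> r \<le> t) \<longrightarrow> 0 \<le> t \<longrightarrow>
       T t x = (\<Sum>r\<in>F. T (\<tau> r) (g r)) \<longrightarrow> norm x \<le> \<kappa> * (\<Sum>r\<in>F. norm (g r))"
    using finite_sum_lower_bound_finite_set[OF flb] by blast
  have "norm x \<le> \<kappa> * (\<Sum>r\<in>G. M * exp (\<omega> * max r 0) * norm (f r))"
    if G: "finite G" and ev: "\<forall>\<^sub>F t in at_top. (\<Sum>r\<in>G. T (t + r) (f r)) = T t x" for G f x
  proof -
    have "\<forall>\<^sub>F t in at_top. (\<Sum>r\<in>G. T (t + r) (f r)) = T t x \<and> (\<forall>r\<in>G. 0 \<le> t + r) \<and> 0 \<le> t"
      using ev eventually_ge_on_finite[OF G] eventually_ge_at_top[of 0] by eventually_elim simp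
    from eventually_happens'[OF trivial_limit_at_top_linorder this]
    obtain t where t: "(\<Sum>r\<in>G. T (t + r) (f r)) = T t x" "\<forall>r\<in>G. 0 \<le> t + r" "0 \<le> t"
      by blast
    have "norm x \<le> \<kappa> * (\<Sum>r\<in>G. norm (T (max r 0) (f r)))"
    proof (rule bound[rule_format, OF G, where \<tau> = "\<lambda>r. t + min r 0" and t = t])
      show "mono (\<lambda>r. t + min r 0)" by (auto simp: mono_def)
      show "0 \<le> t + min r 0 \<and> t + min r 0 \<le> t" if "r \<in> G" for r using t that by auto
      show "0 \<le> t" by fact
      have "T (t + r) (f r) = T (t + min r 0) (T (max r 0) (f r))" if "r \<in> G" for r
        using T_add[of "t + min r 0" "max r 0" "f r"] t that by (auto simp: min_def max_def)
      then show "T t x = (\<Sum>r\<in>G. T (t + min r 0) (T (max r 0) (f r)))"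
        unfolding t(1)[symmetric] by (rule sum.cong[OF refl])
    qed
    also have "\<dots> \<le> \<kappa> * (\<Sum>r\<in>G. M * exp (\<omega> * max r 0) * norm (f r))"
      using \<kappa> growth by (intro mult_left_mono sum_mono) auto
    finally show ?thesis .
  qed
  with \<kappa> show ?thesis by blast
qed

lemma relation_complement_eventually:
  assumes k: "k \<in> relations"
  shows "\<exists>G. finite G \<and> 0 \<in> G \<and> (\<forall>r. r \<notin> G \<longrightarrow> (point_mass 0 x - k) r = 0) \<and>
    (\<forall>\<^sub>F t in at_top. (\<Sum>r\<in>G. T (t + r) ((point_mass 0 x - k) r)) = T t x)"
proof -
  obtain F where F: "finite F" "\<forall>r. r \<notin> F \<longrightarrow> k r = 0"
    "\<forall>\<^sub>F t in at_top. (\<Sum>r\<in>F. T (t + r) (k r)) = 0"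
    using k by (rule relationsE)
  define G where "G = insert 0 F"
  have G: "finite G" "\<forall>r. r \<notin> G \<longrightarrow> k r = 0" using F by (auto simp: G_def)
  show ?thesis
  proof (intro exI[of _ G] conjI)
    show "finite G" "0 \<in> G" using G by (auto simp: G_def)
    show "\<forall>r. r \<notin> G \<longrightarrow> (point_mass 0 x - k) r = 0"
      using F(2) by (auto simp: G_def point_mass_def)
    show "\<forall>\<^sub>F t in at_top. (\<Sum>r\<in>G. T (t + r) ((point_mass 0 x - k) r)) = T t x"
      using relations_eventually[OF k G] eventually_ge_on_finite[OF G(1)]
    proof eventually_elim
      case (elim t)
      have "(\<Sum>r\<in>G. T (t + r) ((point_mass 0 x - k) r))
          = (\<Sum>r\<in>G. T (t + r) (point_mass 0 x r)) - (\<Sum>r\<in>G. T (t + r) (k r))"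
        unfolding sum_subtractf[symmetric] by (rule sum.cong) (use elim(2) T_diff in auto)
      also have "(\<Sum>r\<in>G. T (t + r) (point_mass 0 x r)) = (\<Sum>r\<in>G. if r = 0 then T t x else 0)"
        by (rule sum.cong) (use elim(2) T_zero in \<open>auto simp: point_mass_def\<close>)
      also have "\<dots> = T t x" using G(1) by (simp add: G_def)
      finally show ?case using elim(1) by simp
    qed
  qed
qed

text \<open>The weight is nondecreasing in \<open>r\<close>, so translations to the left are contractions.\<close>

lemma finite_sum_lower_bound_imp_backward_contractive_group:
  assumes flb: "finite_sum_lower_bound T"
  shows "embeds_in_backward_contractive_group TYPE(real \<Rightarrow> 'a) T"
proof -
  obtain M \<omega> where M: "M \<ge> 1" and \<omega>: "\<omega> \<ge> 0"
    and growth: "\<And>t x. 0 \<le> t \<Longrightarrow> norm (T t x) \<le> M * exp (\<omega> * t) * norm x"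
    using exponentially_bounded by blast
  define w where "w r = M * exp (\<omega> * max r 0)" for r
  obtain \<kappa> where \<kappa>: "\<kappa> \<ge> 1"
    and bound: "\<forall>G f x. finite G \<longrightarrow> (\<forall>\<^sub>F t in at_top. (\<Sum>r\<in>G. T (t + r) (f r)) = T t x) \<longrightarrow>
       norm x \<le> \<kappa> * (\<Sum>r\<in>G. w r * norm (f r))"
    unfolding w_def using lower_bound_modulo_relations[OF flb M \<omega> growth] by blast
  have inv_\<kappa>: "1 / \<kappa> > 0" using \<kappa> by simp
  have weight: "weight w" using M by unfold_locales (simp add: w_def)
  have shift: "w (r + t) \<le> 1 * exp (\<omega> * max t 0) * w r" for r t
  proof -
    have "\<omega> * max (r + t) 0 \<le> \<omega> * (max t 0 + max r 0)" using \<omega> by (intro mult_left_mono) auto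
    then have "exp (\<omega> * max (r + t) 0) \<le> exp (\<omega> * max t 0) * exp (\<omega> * max r 0)"
      by (simp add: exp_add[symmetric] algebra_simps)
    then show ?thesis using M by (simp add: w_def mult.left_commute)
  qed
  have low: "(1 / \<kappa>) * norm x \<le> l1_norm w (point_mass 0 x - k)" if k: "k \<in> relations" for x k
  proof -
    obtain G where G: "finite G" "\<forall>r. r \<notin> G \<longrightarrow> (point_mass 0 x - k) r = 0"
      "\<forall>\<^sub>F t in at_top. (\<Sum>r\<in>G. T (t + r) ((point_mass 0 x - k) r)) = T t x"
      using relation_complement_eventually[OF k, of x] by blast
    have "norm x \<le> \<kappa> * l1_norm w (point_mass 0 x - k)"
      
      using bound[rule_format, OF G(1,3)]
        weight.finite_support_l1(2)[where f = "point_mass 0 x - k", OF weight G(1) G(2)[rule_format]]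
      by metis
    then show ?thesis using \<kappa> by (simp add: field_simps)
  qed
  show ?thesis
  proof (rule group_from_weight[OF weight zero_le_one \<omega> shift inv_\<kappa> low])
    fix V :: "(real \<Rightarrow> 'a) set" and N J S
    assume V: "complex_banach_on V N" and S: "C0_group_on V N S" and JV: "range J \<subseteq> V"
    and J_lin: "\<And>x y. J (x + y) = J x + J y" "\<And>a x. J (a *\<^sub>C x) = a *\<^sub>C J x"
    and J_low: "\<And>x. (1 / \<kappa>) * norm x \<le> N (J x)" and J_up: "\<And>x. N (J x) \<le> w 0 * norm x"
    and ext: "\<And>t x. 0 \<le> t \<Longrightarrow> S t (J x) = J (T t x)"
    and S_bd: "\<And>t y. y \<in> V \<Longrightarrow> N (S t y) \<le> 1 * exp (\<omega> * max t 0) * N y"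
    have N: "complex_norm_on V N" using V unfolding complex_banach_on_def by blast
    interpret complex_norm V N using N by unfold_locales
    have inj: "inj J"
    proof (rule injI)
      fix x y assume "J x = J y"
      moreover have "J (x - y) = J x - J y" using J_lin(1)[of "x - y" y] by (simp add: algebra_simps)
      moreover have "0 \<in> V" using cvec.subspace_0[OF subspace_W] .
      ultimately have "N (J (x - y)) = 0" using eq_0[of 0] by simp
      then have "(1 / \<kappa>) * norm (x - y) \<le> 0" using J_low[of "x - y"] by simp
      then show "x = y" using inv_\<kappa> by (simp add: mult_le_0_iff divide_le_0_iff)
    qed
    have "isomorphic_embedding V N J"
      unfolding isomorphic_embedding_def
    proof (intro conjI inj)
      show "closed_csubspace_on V N (range J)"
        by (rule range_closed_if_bounded_below[where b = "1 / \<kappa>" and C = "w 0", OF N JV J_lin])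
          (simp_all only: inv_\<kappa> J_low J_up)
      show "bounded_clinear_on UNIV norm (range J) N J"
        unfolding bounded_clinear_on_def using J_lin J_up by auto
      have inv_norm: "norm x \<le> \<kappa> * N (J x)" for x using J_low[of x] \<kappa> by (simp add: field_simps)
      show "bounded_clinear_on (range J) N UNIV norm (inv J)"
        unfolding bounded_clinear_on_def
        using inj inv_norm by (auto simp: J_lin[symmetric] intro!: exI[of _ \<kappa>])
    qed
    moreover have "op_norm_on V N (S (- t)) \<le> 1" if "t > 0" for t
      using that S_bd[of _ "- t"] by (intro op_norm_on_le[OF N]) auto
    ultimately show ?thesis
      unfolding embeds_in_backward_contractive_group_def using V S ext by (meson less_imp_le)
  qed
qed

text \<open>The weight is \<open>1\<close> at \<open>0\<close> and \<open>\<kappa>\<close> times the natural weight elsewhere. If \<open>f\<close> equals the point mass \<open>x\<close> at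
\<open>0\<close> modulo relations, then \<open>x - f 0\<close> is represented by the other values of \<open>f\<close>, so
\<open>\<parallel>x\<parallel> \<le> \<parallel>f 0\<parallel> + \<parallel>x - f 0\<parallel>\<close> is at most the norm of \<open>f\<close>. Hence the embedding is isometric. The price is the
factor \<open>D\<close> for backward translations, as the weight is no longer monotone at \<open>0\<close>.\<close>

lemma finite_sum_lower_bound_imp_backward_bounded_group:
  assumes flb: "finite_sum_lower_bound T"
  shows "extends_to_backward_bounded_group TYPE(real \<Rightarrow> 'a) T"
proof -
  obtain M \<omega> where M: "M \<ge> 1" and \<omega>: "\<omega> \<ge> 0"
    and growth: "\<And>t x. 0 \<le> t \<Longrightarrow> norm (T t x) \<le> M * exp (\<omega> * t) * norm x"
    using exponentially_bounded by blast
  obtain \<kappa> where \<kappa>: "\<kappa> \<ge> 1"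
    and bound: "\<forall>G f x. finite G \<longrightarrow> (\<forall>\<^sub>F t in at_top. (\<Sum>r\<in>G. T (t + r) (f r)) = T t x) \<longrightarrow>
       norm x \<le> \<kappa> * (\<Sum>r\<in>G. M * exp (\<omega> * max r 0) * norm (f r))"
    using lower_bound_modulo_relations[OF flb M \<omega> growth] by blast
  define D where "D = \<kappa> * M"
  have D: "D \<ge> 1" using mult_mono[of 1 \<kappa> 1 M] \<kappa> M by (simp add: D_def)
  define w where "w r = (if r = 0 then 1 else D * exp (\<omega> * max r 0))" for r :: real
  have weight: "weight w" using D by unfold_locales (auto simp: w_def)
  have shift: "w (r + t) \<le> D * exp (\<omega> * max t 0) * w r" for r t
  proof -
    have e: "1 \<le> exp (\<omega> * max s 0)" for s using \<omega> by simp
    have De: "1 \<le> D * exp (\<omega> * max s 0)" for s using mult_mono[of 1 D 1] D e by fastforce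
    have w_le: "w s \<le> D * exp (\<omega> * max s 0)" for s using De[of s] by (auto simp: w_def)
    show ?thesis
    proof (cases "r = 0")
      case True
      then show ?thesis using w_le[of t] by (simp add: w_def)
    next
      case False
      have "\<omega> * max (r + t) 0 \<le> \<omega> * (max t 0 + max r 0)" using \<omega> by (intro mult_left_mono) auto
      then have "exp (\<omega> * max (r + t) 0) \<le> exp (\<omega> * max t 0) * exp (\<omega> * max r 0)"
        by (simp add: exp_add[symmetric] algebra_simps)
      then have "w (r + t) \<le> D * (exp (\<omega> * max t 0) * exp (\<omega> * max r 0))"
        using w_le[of "r + t"] D by (meson mult_left_mono order_trans zero_le_one)
      also have "\<dots> \<le> D * (D * (exp (\<omega> * max t 0) * exp (\<omega> * max r 0)))"
        using D by (intro mult_left_mono) auto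
      finally show ?thesis using False by (simp add: w_def mult.left_commute mult.assoc)
    qed
  qed
  have low: "1 * norm x \<le> l1_norm w (point_mass 0 x - k)" if k: "k \<in> relations" for x k
  proof -
    define f where "f = point_mass 0 x - k"
    obtain G where G: "finite G" "0 \<in> G" "\<forall>r. r \<notin> G \<longrightarrow> f r = 0"
      "\<forall>\<^sub>F t in at_top. (\<Sum>r\<in>G. T (t + r) (f r)) = T t x"
      unfolding f_def using relation_complement_eventually[OF k, of x] by blast
    have "\<forall>\<^sub>F t in at_top. (\<Sum>r\<in>G - {0}. T (t + r) (f r)) = T t (x - f 0)"
      using G(4) eventually_ge_at_top[of 0]
    proof eventually_elim
      case (elim t)
      have "(\<Sum>r\<in>G. T (t + r) (f r)) = T t (f 0) + (\<Sum>r\<in>G - {0}. T (t + r) (f r))"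
        using sum.remove[OF G(1,2), of "\<lambda>r. T (t + r) (f r)"] by simp
      then show ?case using elim by (simp add: T_diff algebra_simps)
    qed
    then have "norm (x - f 0) \<le> \<kappa> * (\<Sum>r\<in>G - {0}. M * exp (\<omega> * max r 0) * norm (f r))"
      using G(1) by (intro bound[rule_format]) auto
    also have "\<dots> = (\<Sum>r\<in>G - {0}. w r * norm (f r))"
      unfolding sum_distrib_left by (rule sum.cong) (auto simp: w_def D_def)
    finally have "norm x \<le> norm (f 0) + (\<Sum>r\<in>G - {0}. w r * norm (f r))"
      using norm_triangle_sub[of x "f 0"] by simp
    also have "\<dots> = (\<Sum>r\<in>G. w r * norm (f r))"
      using sum.remove[OF G(1,2), of "\<lambda>r. w r * norm (f r)"] by (simp add: w_def)
    also have "\<dots> = l1_norm w f"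
      using weight.finite_support_l1(2)[where f = f, OF weight G(1) G(3)[rule_format]] by simp
    finally show ?thesis by (simp add: f_def)
  qed
  have "D \<ge> 0" using D by simp
  show ?thesis
  proof (rule group_from_weight[OF weight \<open>D \<ge> 0\<close> \<omega> shift zero_less_one low])
    fix V :: "(real \<Rightarrow> 'a) set" and N J S
    assume V: "complex_banach_on V N" and S: "C0_group_on V N S" and JV: "range J \<subseteq> V"
    and J_lin: "\<And>x y. J (x + y) = J x + J y" "\<And>a x. J (a *\<^sub>C x) = a *\<^sub>C J x"
    and J_low: "\<And>x. 1 * norm x \<le> N (J x)" and J_up: "\<And>x. N (J x) \<le> w 0 * norm x"
    and ext: "\<And>t x. 0 \<le> t \<Longrightarrow> S t (J x) = J (T t x)"
    and S_bd: "\<And>t y. y \<in> V \<Longrightarrow> N (S t y) \<le> D * exp (\<omega> * max t 0) * N y"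
    have N: "complex_norm_on V N" using V unfolding complex_banach_on_def by blast
    have iso: "N (J x) = norm x" for x using J_low[of x] J_up[of x] by (simp add: w_def)
    have "isometric_embedding V N J"
      unfolding isometric_embedding_def
    proof (intro conjI allI iso)
      show "closed_csubspace_on V N (range J)"
        by (rule range_closed_if_bounded_below[where b = 1 and C = "w 0", OF N JV J_lin])
          (simp_all only: zero_less_one J_low J_up)
      show "bounded_clinear_on UNIV norm (range J) N J"
        unfolding bounded_clinear_on_def using J_lin J_up by auto
    qed
    moreover have "C0_group_extension V N J T S"
      unfolding C0_group_extension_def using S ext by auto
    moreover have "op_norm_on V N (S (- t)) \<le> D" if "t \<ge> 0" for t
      using that S_bd[of _ "- t"] D by (intro op_norm_on_le[OF N]) auto
    ultimately show ?thesis
      unfolding extends_to_backward_bounded_group_def using V by blast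
  qed
qed

end

theorem theorem5p5:
  fixes T :: "real \<Rightarrow> 'a \<Rightarrow> 'a::complex_banach"
  assumes "C0_semigroup_on UNIV norm T"
  shows "(dissipative_renorming T
            \<longleftrightarrow> embeds_in_backward_contractive_group TYPE(real \<Rightarrow> 'a) T) \<and>
         (dissipative_renorming T
            \<longleftrightarrow> extends_to_backward_bounded_group TYPE(real \<Rightarrow> 'a) T) \<and>
         (dissipative_renorming T \<longleftrightarrow> finite_sum_lower_bound T) \<and>
         (embeds_in_backward_contractive_group TYPE('y::complex_vector) T
            \<longrightarrow> dissipative_renorming T) \<and>
         (extends_to_backward_bounded_group TYPE('z::complex_vector) T
            \<longrightarrow> dissipative_renorming T)"
proof -
  interpret C0_semigroup T using assms by unfold_locales
  show ?thesis
    using dissipative_imp_finite_sum_lower_bound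
      finite_sum_lower_bound_imp_backward_contractive_group
      finite_sum_lower_bound_imp_backward_bounded_group
      backward_contractive_group_imp_dissipative[where 'y = "real \<Rightarrow> 'a"]
      backward_bounded_group_imp_dissipative[where 'z = "real \<Rightarrow> 'a"]
      backward_contractive_group_imp_dissipative[where 'y = 'y]
      backward_bounded_group_imp_dissipative[where 'z = 'z]
    by blast
qed

end
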